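(* Suppose Condition 1 holds: there is a bounded positive function $w$ on $E$ such that $\mathrm{P}_{\delta_x}(e^{-\langle w,X_t\rangle})=e^{-w(x)}$ for all $x\in E$ and $t\ge0$. Suppose moreover that there is a spatially independent branching mechanism $$\psi(\lambda)=-b\lambda+a\lambda^2+\int_{(0,\infty)}(e^{-\lambda y}-1+\lambda y)\,\eta(dy),\qquad\lambda\ge0,$$ with $b\in\mathbb{R}$, $a\ge 0$ and $\eta$ a measure on $(0,\infty)$ satisfying $\int_{(0,\infty)}(y\wedge y^2)\eta(dy)<\infty$, such that $\psi(\infty)=\infty$, $\int^\infty\psi(\lambda)^{-1}d\lambda<\infty$ (i.e. $\int_N^\infty\psi(\lambda)^{-1}d\lambda<\infty$ for some $N>0$), and $\psi_\beta(x,\lambda)\ge\psi(\lambda)$ for all $x\in E$, $\lambda\ge0$. Then $E_0^*=E$. Consequently, Assumption 1(i) holds, i.e. Condition 1 holds and $$E_+:=\{x\in E:\alpha(x)>0\}\subset E_0\cap E_0^*.$$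
   Context: $E$ is a Luzin topological space, and $\xi=(\xi_t,\Pi_x)$ is an $m$-symmetric Borel right process on $E$ with transition semigroup $P_tf(x)=\Pi_x[f(\xi_t)]$. $\mathcal{B}_b(E)$, $\mathcal{B}_b^+(E)$ are the bounded, bounded nonnegative Borel functions; $\langle f,\mu\rangle=\int f\,d\mu$; $\mathcal{M}_F(E)$ is the space of finite measures on $E$ with the weak topology and $\mathcal{M}_F^+(E)=\mathcal{M}_F(E)\setminus\{0\}$. The branching mechanism is $\psi_\beta(x,\lambda)=-\beta(x)\lambda+\alpha(x)\lambda^2+\int_{(0,\infty)}(e^{-\lambda y}-1+\lambda y)\pi(x,dy)$, $\lambda\ge0$, with $\beta\in\mathcal{B}_b(E)$, $\alpha\in\mathcal{B}_b^+(E)$ and $\pi$ a kernel from $E$ to $(0,\infty)$ with $\sup_x\int_{(0,\infty)}(y\wedge y^2)\pi(x,dy)<\infty$. The $(\xi,\psi_\beta)$-superprocess $X$ (law $\mathrm{P}_\mu$ if $X_0=\mu$) is the $\mathcal{M}_F(E)$-valued right Markov process with $\mathrm{P}_\mu[e^{-\langle f,X_t\rangle}]=e^{-\langle V_tf,\mu\rangle}$ for $f\in\mathcal{B}_b^+(E)$, where $V_tf(x)=u_f(t,x)$ is the unique nonnegative locally bounded (bounded on $[0,T]\times E$ for each $T$) solution of $u_f(t,x)=P_tf(x)-\int_0^tP_s(\psi_\beta(\cdot,u_f(t-s,\cdot)))(x)ds$. For $t>0$ one has $V_tf(x)=\int_Ef(y)\Lambda_t(x,dy)+\int_{\mathcal{M}_F^+(E)}(1-e^{-\langle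 f,\nu\rangle})L_t(x,d\nu)$ with $\Lambda_t$ a bounded kernel on $E$ and $(1\wedge\langle1,\nu\rangle)L_t(x,d\nu)$ a bounded kernel from $E$ to $\mathcal{M}_F^+(E)$. $E_0:=\{x\in E:\Lambda_t(x,E)=0\text{ for all }t>0\}$; this is the set of $x$ for which the Kuznetsov (excursion) measure of the superprocess exists. Under Condition 1, let $\beta^*(x)=\beta(x)-2\alpha(x)w(x)-\int_{(0,\infty)}(1-e^{-w(x)y})y\,\pi(x,dy)$, $\pi^*(x,dy)=e^{-w(x)y}\pi(x,dy)$ and $\psi^*_{\beta^*}(x,\lambda)=-\beta^*(x)\lambda+\alpha(x)\lambda^2+\int_{(0,\infty)}(e^{-\lambda y}-1+\lambda y)\pi^*(x,dy)=\psi_\beta(x,\lambda+w(x))-\psi_\beta(x,w(x))$. The $(\xi,\psi^*_{\beta^*})$-superprocess is $X$ under the laws $\mathrm{P}^*_\mu$ given by $d\mathrm{P}^*_\mu=e^{-\langle w,X_t\rangle+\langle w,\mu\rangle}d\mathrm{P}_\mu$ on $\sigma(X_s:s\le t)$, $t\ge 0$. $E_0^*$ is the set defined in the same way as $E_0$ but for the $(\xi,\psi^*_{\beta^*})$-superprocess. *)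

theory Defs
  imports "HOL-Probability.Probability"
begin

section \<open>Topological and measurable preliminaries\<close>

definition borel_of :: "'s topology \<Rightarrow> 's measure" where
  "borel_of T = sigma (topspace T) {U. openin T U}"

text \<open>
  A space is Luzin if it is homeomorphic to a Borel subset of a compact metrizable space. A compact
  metrizable space has at most the cardinality of the continuum, so the points of \<open>K\<close> may be taken
  to be reals; \<open>K\<close> is an arbitrary topology and need not be related to the usual one.
\<close>

definition luzin_space :: "'s topology \<Rightarrow> bool" where
  "luzin_space T \<longleftrightarrow>
     (\<exists>(K :: real topology) B. metrizable_space K \<and> compact_space K \<and> B \<in> sets (borel_of K) \<and>
        T homeomorphic_space subtopology K B)"

definition universally_measurable :: "'s topology \<Rightarrow> ('s \<Rightarrow> ennreal) \<Rightarrow> bool" where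
  "universally_measurable T f \<longleftrightarrow>
     (\<forall>\<mu>. sets \<mu> = sets (borel_of T) \<longrightarrow> finite_measure \<mu> \<longrightarrow> f \<in> borel_measurable (completion \<mu>))"

definition bounded_borel :: "('a::topological_space \<Rightarrow> real) set" where
  "bounded_borel = {f \<in> borel_measurable borel. bounded (range f)}"

definition bounded_borel_nonneg :: "('a::topological_space \<Rightarrow> real) set" where
  "bounded_borel_nonneg = {f \<in> bounded_borel. \<forall>x. 0 \<le> f x}"

definition finite_measures :: "'a::topological_space measure set" where
  "finite_measures = {\<mu>. sets \<mu> = sets borel \<and> finite_measure \<mu>}"

text \<open>The weak topology: the coarsest one for which \<open>\<mu> \<mapsto> \<langle>f, \<mu>\<rangle>\<close> is continuous for every bounded
  continuous \<open>f\<close>.\<close>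

definition weak_topology :: "'a::topological_space measure topology" where
  "weak_topology = topology_generated_by
     {{\<mu> \<in> finite_measures. integral\<^sup>L \<mu> f \<in> U} | f U.
        continuous_on UNIV f \<and> bounded (range f) \<and> open (U :: real set)}"

lemma topspace_weak_topology [simp]: "topspace weak_topology = finite_measures"
proof -
  have "\<exists>f U. (finite_measures :: 'a measure set) = {\<mu> \<in> finite_measures. integral\<^sup>L \<mu> f \<in> U} \<and>
      continuous_on UNIV f \<and> bounded (range f) \<and> open (U :: real set)"
    by (intro exI[of _ "\<lambda>_. 0"] exI[of _ UNIV]) auto
  then show ?thesis
    unfolding weak_topology_def topology_generated_by_topspace by blast
qed


section \<open>Right processes\<close>

definition transition_measure ::
  "'s topology \<Rightarrow> (real \<Rightarrow> 'w \<Rightarrow> 's) \<Rightarrow> ('s \<Rightarrow> 'w measure) \<Rightarrow> real \<Rightarrow> 's \<Rightarrow> 's measure" where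
  "transition_measure T X Q t x = distr (Q x) (borel_of T) (X t)"

text \<open>For \<open>a > 0\<close>, \<open>a\<close>-excessive functions, in the universally measurable sense.\<close>

definition excessive ::
  "'s topology \<Rightarrow> (real \<Rightarrow> 'w \<Rightarrow> 's) \<Rightarrow> ('s \<Rightarrow> 'w measure) \<Rightarrow> real \<Rightarrow> ('s \<Rightarrow> ennreal) \<Rightarrow> bool" where
  "excessive T X Q a f \<longleftrightarrow> universally_measurable T f \<and>
     (\<forall>x\<in>topspace T.
        (\<forall>t\<ge>0. ennreal (exp (- a * t)) * (\<integral>\<^sup>+y. f y \<partial>completion (transition_measure T X Q t x)) \<le> f x) \<and>
        ((\<lambda>t. ennreal (exp (- a * t)) * (\<integral>\<^sup>+y. f y \<partial>completion (transition_measure T X Q t x)))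
           \<longlongrightarrow> f x) (at_right 0))"

definition natural_filtration ::
  "'s topology \<Rightarrow> 'w measure \<Rightarrow> (real \<Rightarrow> 'w \<Rightarrow> 's) \<Rightarrow> real \<Rightarrow> 'w set set" where
  "natural_filtration T \<Omega> X t =
     sigma_sets (space \<Omega>) {X r -` B \<inter> space \<Omega> | r B. 0 \<le> r \<and> r \<le> t \<and> B \<in> sets (borel_of T)}"

text \<open>
  A right process in the sense of Sharpe: a normal, right-continuous Markov process along whose paths
  \<open>a\<close>-excessive functions are almost surely right-continuous (this entails the strong Markov
  property). Only the sample space and the \<open>\<sigma>\<close>-algebra of \<open>\<Omega>\<close> are used; the laws are \<open>Q x\<close>.
  The semigroup is only required to preserve universal measurability, so the Markov property is
  integrated against the completed laws.
\<close>

locale right_process =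
  fixes T :: "'s topology" and \<Omega> :: "'w measure"
    and X :: "real \<Rightarrow> 'w \<Rightarrow> 's" and Q :: "'s \<Rightarrow> 'w measure"
  assumes prob_space_law: "x \<in> topspace T \<Longrightarrow> prob_space (Q x)"
    and sets_law: "x \<in> topspace T \<Longrightarrow> sets (Q x) = sets \<Omega>"
    and measurable_process: "0 \<le> t \<Longrightarrow> X t \<in> measurable \<Omega> (borel_of T)"
    and measurable_transition: "0 \<le> t \<Longrightarrow> B \<in> sets (borel_of T) \<Longrightarrow>
          universally_measurable T (\<lambda>x. emeasure (transition_measure T X Q t x) B)"
    and normal: "x \<in> topspace T \<Longrightarrow> AE \<omega> in Q x. X 0 \<omega> = x"
    and right_continuous: "\<omega> \<in> space \<Omega> \<Longrightarrow> 0 \<le> t \<Longrightarrow> limitin T (\<lambda>s. X s \<omega>) (X t \<omega>) (at_right t)"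
    and markov: "x \<in> topspace T \<Longrightarrow> 0 \<le> s \<Longrightarrow> 0 \<le> t \<Longrightarrow> B \<in> sets (borel_of T) \<Longrightarrow>
          A \<in> natural_filtration T \<Omega> X t \<Longrightarrow>
          emeasure (Q x) {\<omega> \<in> A. X (t + s) \<omega> \<in> B} =
            (\<integral>\<^sup>+\<omega>\<in>A. emeasure (transition_measure T X Q s (X t \<omega>)) B \<partial>completion (Q x))"
    and excessive_right_continuous: "x \<in> topspace T \<Longrightarrow> 0 < a \<Longrightarrow> excessive T X Q a f \<Longrightarrow>
          AE \<omega> in Q x. \<forall>t\<ge>0. ((\<lambda>s. f (X s \<omega>)) \<longlongrightarrow> f (X t \<omega>)) (at_right t)"

text \<open>The space \<open>T\<close> with a cemetery \<open>None\<close> adjoined as an isolated point.\<close>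

definition cemetery_topology :: "'s topology \<Rightarrow> 's option topology" where
  "cemetery_topology T = topology (\<lambda>U. openin T (Some -` U))"

lemma openin_cemetery_topology [simp]:
  "openin (cemetery_topology T) U \<longleftrightarrow> openin T (Some -` U)"
proof -
  have "istopology (\<lambda>U. openin T (Some -` U))"
    unfolding istopology_def by (auto simp: vimage_Union)
  then show ?thesis
    by (simp add: cemetery_topology_def topology_inverse')
qed

text \<open>
  A Borel right process on a Luzin space, possibly with finite lifetime: paths stay in the cemetery
  \<open>None\<close> once they have reached it. Processes of infinite lifetime are those never reaching \<open>None\<close>.
\<close>

locale borel_right_process =
  right_process "cemetery_topology T" \<Omega> X Q
  for T :: "'s topology" and \<Omega> :: "'w measure"
    and X :: "real \<Rightarrow> 'w \<Rightarrow> 's option" and Q :: "'s option \<Rightarrow> 'w measure" +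
  assumes luzin: "luzin_space T"
    and borel_transition: "0 \<le> t \<Longrightarrow> B \<in> sets (borel_of (cemetery_topology T)) \<Longrightarrow>
          (\<lambda>x. emeasure (transition_measure (cemetery_topology T) X Q t x) B)
            \<in> borel_measurable (borel_of (cemetery_topology T))"
    and absorbing: "\<omega> \<in> space \<Omega> \<Longrightarrow> 0 \<le> s \<Longrightarrow> s \<le> t \<Longrightarrow> X s \<omega> = None \<Longrightarrow> X t \<omega> = None"

text \<open>\<open>P\<^sub>t f(x) = Q\<^sub>x[f(X\<^sub>t)]\<close>, where functions on the state space vanish at the cemetery.\<close>

definition transition_semigroup ::
  "(real \<Rightarrow> 'w \<Rightarrow> 'a option) \<Rightarrow> ('a option \<Rightarrow> 'w measure) \<Rightarrow> real \<Rightarrow> ('a \<Rightarrow> real) \<Rightarrow> 'a \<Rightarrow> real" where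
  "transition_semigroup X Q t f x = (\<integral>\<omega>. case_option 0 f (X t \<omega>) \<partial>Q (Some x))"

definition symmetric_semigroup ::
  "'a::topological_space measure \<Rightarrow> (real \<Rightarrow> ('a \<Rightarrow> real) \<Rightarrow> 'a \<Rightarrow> real) \<Rightarrow> bool" where
  "symmetric_semigroup m P \<longleftrightarrow> sets m = sets borel \<and>
     (\<forall>t\<ge>0. \<forall>f\<in>bounded_borel_nonneg. \<forall>g\<in>bounded_borel_nonneg.
        (\<integral>\<^sup>+x. ennreal (f x * P t g x) \<partial>m) = (\<integral>\<^sup>+x. ennreal (P t f x * g x) \<partial>m))"


section \<open>Branching mechanisms\<close>

definition pos_borel :: "real measure" where
  "pos_borel = restrict_space borel {0<..}"

definition branching_function :: "real \<Rightarrow> real \<Rightarrow> real measure \<Rightarrow> real \<Rightarrow> real" where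
  "branching_function b a \<eta> l = - b * l + a * l\<^sup>2 + (\<integral>y. (exp (- l * y) - 1 + l * y) \<partial>\<eta>)"

definition branching_mechanism ::
  "('a \<Rightarrow> real) \<Rightarrow> ('a \<Rightarrow> real) \<Rightarrow> ('a \<Rightarrow> real measure) \<Rightarrow> 'a \<Rightarrow> real \<Rightarrow> real" where
  "branching_mechanism \<beta> \<alpha> \<pi> x l = branching_function (\<beta> x) (\<alpha> x) (\<pi> x) l"

definition admissible_branching ::
  "('a::topological_space \<Rightarrow> real) \<Rightarrow> ('a \<Rightarrow> real) \<Rightarrow> ('a \<Rightarrow> real measure) \<Rightarrow> bool" where
  "admissible_branching \<beta> \<alpha> \<pi> \<longleftrightarrow>
     \<beta> \<in> bounded_borel \<and> \<alpha> \<in> bounded_borel_nonneg \<and>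
     (\<forall>x. sets (\<pi> x) = sets pos_borel) \<and>
     (\<forall>B\<in>sets pos_borel. (\<lambda>x. emeasure (\<pi> x) B) \<in> borel_measurable borel) \<and>
     (SUP x. \<integral>\<^sup>+y. ennreal (min y (y\<^sup>2)) \<partial>\<pi> x) < \<infinity>"

definition beta_star ::
  "('a \<Rightarrow> real) \<Rightarrow> ('a \<Rightarrow> real) \<Rightarrow> ('a \<Rightarrow> real measure) \<Rightarrow> ('a \<Rightarrow> real) \<Rightarrow> 'a \<Rightarrow> real" where
  "beta_star \<beta> \<alpha> \<pi> w x = \<beta> x - 2 * \<alpha> x * w x - (\<integral>y. (1 - exp (- w x * y)) * y \<partial>\<pi> x)"

definition pi_star :: "('a \<Rightarrow> real measure) \<Rightarrow> ('a \<Rightarrow> real) \<Rightarrow> 'a \<Rightarrow> real measure" where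
  "pi_star \<pi> w x = density (\<pi> x) (\<lambda>y. ennreal (exp (- w x * y)))"

definition star_branching_mechanism ::
  "('a \<Rightarrow> real) \<Rightarrow> ('a \<Rightarrow> real) \<Rightarrow> ('a \<Rightarrow> real measure) \<Rightarrow> ('a \<Rightarrow> real) \<Rightarrow> 'a \<Rightarrow> real \<Rightarrow> real" where
  "star_branching_mechanism \<beta> \<alpha> \<pi> w = branching_mechanism (beta_star \<beta> \<alpha> \<pi> w) \<alpha> (pi_star \<pi> w)"


section \<open>Superprocesses\<close>

text \<open>Below, \<open>P\<close> is the semigroup of the spatial motion and \<open>\<psi> x l\<close> the branching mechanism.\<close>

definition mild_solution ::
  "(real \<Rightarrow> ('a \<Rightarrow> real) \<Rightarrow> 'a \<Rightarrow> real) \<Rightarrow> ('a::topological_space \<Rightarrow> real \<Rightarrow> real) \<Rightarrow>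
     ('a \<Rightarrow> real) \<Rightarrow> (real \<Rightarrow> 'a \<Rightarrow> real) \<Rightarrow> bool" where
  "mild_solution P \<psi> f u \<longleftrightarrow>
     (\<lambda>(t, x). u t x) \<in> borel_measurable (restrict_space borel {0..} \<Otimes>\<^sub>M borel) \<and>
     (\<forall>t\<ge>0. \<forall>x. 0 \<le> u t x) \<and>
     (\<forall>T\<ge>0. \<exists>C. \<forall>t\<in>{0..T}. \<forall>x. u t x \<le> C) \<and>
     (\<forall>t\<ge>0. \<forall>x. u t x = P t f x - (LINT s:{0..t}|lborel. P s (\<lambda>y. \<psi> y (u (t - s) y)) x))"

definition unique_mild_solution ::
  "(real \<Rightarrow> ('a \<Rightarrow> real) \<Rightarrow> 'a \<Rightarrow> real) \<Rightarrow> ('a::topological_space \<Rightarrow> real \<Rightarrow> real) \<Rightarrow>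
     ('a \<Rightarrow> real) \<Rightarrow> (real \<Rightarrow> 'a \<Rightarrow> real) \<Rightarrow> bool" where
  "unique_mild_solution P \<psi> f u \<longleftrightarrow>
     mild_solution P \<psi> f u \<and> (\<forall>u'. mild_solution P \<psi> f u' \<longrightarrow> (\<forall>t\<ge>0. u' t = u t))"

text \<open>The value \<open>V\<^sub>t f(x)\<close>; mild solutions are only determined at times \<open>t \<ge> 0\<close>, hence the
  description of the value rather than of the whole function.\<close>

definition cumulant ::
  "(real \<Rightarrow> ('a \<Rightarrow> real) \<Rightarrow> 'a \<Rightarrow> real) \<Rightarrow> ('a::topological_space \<Rightarrow> real \<Rightarrow> real) \<Rightarrow>
     real \<Rightarrow> ('a \<Rightarrow> real) \<Rightarrow> 'a \<Rightarrow> real" where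
  "cumulant P \<psi> t f x = (THE v. \<exists>u. mild_solution P \<psi> f u \<and> v = u t x)"

locale superprocess =
  right_process weak_topology \<Omega> X Pr
  for P :: "real \<Rightarrow> ('a::topological_space \<Rightarrow> real) \<Rightarrow> 'a \<Rightarrow> real"
    and \<psi> :: "'a \<Rightarrow> real \<Rightarrow> real"
    and \<Omega> :: "'w measure" and X :: "real \<Rightarrow> 'w \<Rightarrow> 'a measure"
    and Pr :: "'a measure \<Rightarrow> 'w measure" +
  assumes cumulant_equation: "f \<in> bounded_borel_nonneg \<Longrightarrow>
          unique_mild_solution P \<psi> f (\<lambda>t. cumulant P \<psi> t f)"
    and laplace_functional: "f \<in> bounded_borel_nonneg \<Longrightarrow> \<mu> \<in> finite_measures \<Longrightarrow> 0 \<le> t \<Longrightarrow>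
          (\<integral>\<omega>. exp (- integral\<^sup>L (X t \<omega>) f) \<partial>Pr \<mu>) = exp (- integral\<^sup>L \<mu> (cumulant P \<psi> t f))"


section \<open>Canonical representation of the cumulant semigroup\<close>

definition nonzero_finite_measures :: "'a::topological_space measure set" where
  "nonzero_finite_measures = finite_measures - {null_measure borel}"

definition nonzero_measure_space :: "'a::topological_space measure measure" where
  "nonzero_measure_space = restrict_space (borel_of weak_topology) nonzero_finite_measures"

definition bounded_kernel :: "'b measure \<Rightarrow> ('a::topological_space \<Rightarrow> 'b set \<Rightarrow> ennreal) \<Rightarrow> bool" where
  "bounded_kernel M K \<longleftrightarrow>
     (\<forall>B\<in>sets M. (\<lambda>x. K x B) \<in> borel_measurable borel) \<and> (SUP x. K x (space M)) < \<infinity>"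

definition canonical_representation ::
  "(real \<Rightarrow> ('a::topological_space \<Rightarrow> real) \<Rightarrow> 'a \<Rightarrow> real) \<Rightarrow>
     (real \<Rightarrow> 'a \<Rightarrow> 'a measure) \<Rightarrow> (real \<Rightarrow> 'a \<Rightarrow> 'a measure measure) \<Rightarrow> bool" where
  "canonical_representation V \<Lambda> L \<longleftrightarrow> (\<forall>t>0.
     (\<forall>x. sets (\<Lambda> t x) = sets borel) \<and>
     bounded_kernel borel (\<lambda>x. emeasure (\<Lambda> t x)) \<and>
     (\<forall>x. sets (L t x) = sets nonzero_measure_space) \<and>
     bounded_kernel nonzero_measure_space (\<lambda>x A. \<integral>\<^sup>+\<nu>\<in>A. min 1 (emeasure \<nu> UNIV) \<partial>L t x) \<and>
     (\<forall>f\<in>bounded_borel_nonneg. \<forall>x.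
        V t f x = (\<integral>y. f y \<partial>\<Lambda> t x) + (\<integral>\<nu>. (1 - exp (- integral\<^sup>L \<nu> f)) \<partial>L t x)))"

definition E_zero :: "(real \<Rightarrow> 'a \<Rightarrow> 'a measure) \<Rightarrow> 'a set" where
  "E_zero \<Lambda> = {x. \<forall>t>0. emeasure (\<Lambda> t x) UNIV = 0}"


section \<open>The standing conditions\<close>

definition condition1 ::
  "(real \<Rightarrow> 'w \<Rightarrow> 'a::topological_space measure) \<Rightarrow> ('a measure \<Rightarrow> 'w measure) \<Rightarrow>
     ('a \<Rightarrow> real) \<Rightarrow> bool" where
  "condition1 X Pr w \<longleftrightarrow> w \<in> bounded_borel \<and> (\<forall>x. 0 < w x) \<and>
     (\<forall>x. \<forall>t\<ge>0. (\<integral>\<omega>. exp (- integral\<^sup>L (X t \<omega>) w) \<partial>Pr (return borel x)) = exp (- w x))"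

definition E_plus :: "('a \<Rightarrow> real) \<Rightarrow> 'a set" where
  "E_plus \<alpha> = {x. 0 < \<alpha> x}"

definition assumption1i ::
  "(real \<Rightarrow> 'w \<Rightarrow> 'a::topological_space measure) \<Rightarrow> ('a measure \<Rightarrow> 'w measure) \<Rightarrow>
     ('a \<Rightarrow> real) \<Rightarrow> ('a \<Rightarrow> real) \<Rightarrow>
     (real \<Rightarrow> 'a \<Rightarrow> 'a measure) \<Rightarrow> (real \<Rightarrow> 'a \<Rightarrow> 'a measure) \<Rightarrow> bool" where
  "assumption1i X Pr w \<alpha> \<Lambda> \<Lambda>' \<longleftrightarrow> condition1 X Pr w \<and> E_plus \<alpha> \<subseteq> E_zero \<Lambda> \<inter> E_zero \<Lambda>'"

end

theory Submission
  imports Defs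
begin

text \<open>
A point \<open>x\<close> belongs to \<open>E_zero\<close> exactly when the linear part \<open>\<Lambda>\<^sub>t(x, \<cdot>)\<close> of the cumulant vanishes for all
\<open>t > 0\<close>. In the canonical representation the part coming from \<open>L\<close> is nonnegative, so evaluation at a
constant function gives \<open>c \<Lambda>\<^sub>t(x, E) \<le> V\<^sub>t c(x)\<close> for every \<open>c \<ge> 0\<close>. Hence it suffices that
\<open>V\<^sub>t c(x)\<close> stays bounded as \<open>c \<longrightarrow> \<infinity>\<close> (\<open>E_zero_of_bounded_cumulant\<close>).

For the original mechanism this is "coming down from infinity". Fix \<open>t\<close> and \<open>x\<close>, let \<open>u\<close> be a mild
solution and put \<open>F(s) = P\<^sub>t\<^sub>-\<^sub>s(u\<^sub>s)(x)\<close>, so that \<open>F(0) = P\<^sub>t f(x)\<close> and \<open>F(t) = u\<^sub>t(x)\<close>. The mild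
equation, the semigroup property and Fubini give \<open>F(s) = F(0) - \<integral>\<^sub>0\<^sup>s g(r) dr\<close> with
\<open>g(r) = P\<^sub>t\<^sub>-\<^sub>r(\<psi>\<^sub>\<beta>(\<cdot>, u\<^sub>r))(x)\<close> (\<open>mild_solution_flow\<close>). The mechanism dominates the convex function
\<open>\<psi>\<close>, and \<open>P\<close> is sub-Markov, so bounding \<open>\<psi>\<close> from below by its tangent at \<open>M\<close> yields \<open>g(r) \<ge> \<psi>(M)\<close>
as long as \<open>F(r) \<ge> M\<close>: this is Jensen's inequality, and it reduces the evolution equation to a scalar
differential inequality. Thus \<open>F\<close> falls from \<open>2M\<close> to \<open>M\<close> within time \<open>M / \<psi>(M)\<close>. The times
\<open>2\<^sup>j N / \<psi>(2\<^sup>j N)\<close> are summable because \<open>1 / \<psi>\<close> is integrable at infinity, so from an arbitrarily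
high starting level \<open>F\<close> reaches a fixed level \<open>M\<close> before time \<open>t\<close>, where \<open>M\<close> depends on \<open>t\<close> alone
(\<open>mild_solution_instantaneous_bound\<close>).

For the tilted mechanism, the martingale condition on \<open>w\<close> says that \<open>V\<^sub>t w = w\<close>. Since
\<open>\<psi>\<^sup>*(x, l) = \<psi>\<^sub>\<beta>(x, l + w(x)) - \<psi>\<^sub>\<beta>(x, w(x))\<close>, adding \<open>w\<close> turns mild solutions for \<open>\<psi>\<^sup>*\<close> with initial
value \<open>f\<close> into mild solutions for \<open>\<psi>\<^sub>\<beta>\<close> with initial value \<open>f + w\<close>, and conversely
(\<open>mild_equation_shift\<close>). Existence and uniqueness are therefore inherited, the cumulant of \<open>\<psi>\<^sup>*\<close>
is \<open>V\<^sub>t(f + w) - w\<close>, and the bound for \<open>V\<close> applies to it. Both sets \<open>E_zero\<close> are then the whole space.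

The analytic prerequisite is that \<open>(t, x) \<mapsto> P\<^sub>t(x, \<cdot>)\<close> is jointly measurable; it comes from the
right-continuity of the paths (\<open>law_jointly_measurable\<close>).
\<close>

section \<open>Bounded Borel functions and integrals depending on a parameter\<close>

lemma bounded_borelI:
  "f \<in> borel_measurable borel \<Longrightarrow> (\<And>x. \<bar>f x\<bar> \<le> B) \<Longrightarrow> f \<in> bounded_borel"
  by (auto simp: bounded_borel_def bounded_iff)

lemma bounded_borelE:
  assumes "f \<in> bounded_borel"
  obtains B where "f \<in> borel_measurable borel" "\<And>x. \<bar>f x\<bar> \<le> B"
  using assms by (auto simp: bounded_borel_def bounded_iff)

lemma bounded_borel_diff: "f \<in> bounded_borel \<Longrightarrow> g \<in> bounded_borel \<Longrightarrow> (\<lambda>x. f x - g x) \<in> bounded_borel"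
  unfolding bounded_borel_def by (auto intro: bounded_minus_comp)

lemma bounded_borel_add: "f \<in> bounded_borel \<Longrightarrow> g \<in> bounded_borel \<Longrightarrow> (\<lambda>x. f x + g x) \<in> bounded_borel"
  unfolding bounded_borel_def by (auto intro: bounded_plus_comp)

lemma bounded_borel_cmult: "f \<in> bounded_borel \<Longrightarrow> (\<lambda>x. c * f x) \<in> bounded_borel"
  unfolding bounded_borel_def
  using bounded_scaleR_comp[of f _ c] by auto

lemma bounded_borel_const: "(\<lambda>x. c) \<in> bounded_borel"
  by (rule bounded_borelI) auto

lemma measurable_section:
  fixes h :: "real \<Rightarrow> 'a::topological_space \<Rightarrow> real"
  assumes "(\<lambda>(r, y). h r y) \<in> borel_measurable (borel \<Otimes>\<^sub>M borel)"
  shows "h r \<in> borel_measurable borel" "(\<lambda>r. h r y) \<in> borel_measurable borel"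
  using measurable_compose[OF measurable_Pair1' assms, of r] measurable_compose[OF measurable_Pair2' assms, of y]
  by auto

text \<open>
Jump kernels may have infinite mass near zero, so the measurability results for kernels of
sub-probability measures do not apply to them.
\<close>

lemma measurable_nn_integral_kernel:
  assumes \<kappa>: "\<And>x. sets (\<kappa> x) = sets N" "\<And>B. B \<in> sets N \<Longrightarrow> (\<lambda>x. emeasure (\<kappa> x) B) \<in> borel_measurable M"
    and f: "f \<in> borel_measurable N"
  shows "(\<lambda>x. \<integral>\<^sup>+y. f y \<partial>\<kappa> x) \<in> borel_measurable M"
proof -
  have meas: "g \<in> borel_measurable (\<kappa> x)" if "g \<in> borel_measurable N" for g :: "_ \<Rightarrow> ennreal" and x
    using that measurable_cong_sets[OF \<kappa>(1) refl] by blast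
  from f show ?thesis
proof induct
  case (cong f g)
  then have "(\<integral>\<^sup>+y. f y \<partial>\<kappa> x) = (\<integral>\<^sup>+y. g y \<partial>\<kappa> x)" for x
    using sets_eq_imp_space_eq[OF \<kappa>(1)] by (intro nn_integral_cong) auto
  with cong show ?case by simp
next
  case (set A)
  then show ?case using \<kappa> by simp
next
  case (mult u c)
  have "(\<integral>\<^sup>+y. c * u y \<partial>\<kappa> x) = c * (\<integral>\<^sup>+y. u y \<partial>\<kappa> x)" for x
    by (rule nn_integral_cmult[OF meas[OF \<open>u \<in> borel_measurable N\<close>]])
  with mult show ?case by simp
next
  case (add u v)
  have "(\<integral>\<^sup>+y. v y + u y \<partial>\<kappa> x) = (\<integral>\<^sup>+y. v y \<partial>\<kappa> x) + (\<integral>\<^sup>+y. u y \<partial>\<kappa> x)" for x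
    by (rule nn_integral_add[OF meas[OF \<open>v \<in> borel_measurable N\<close>] meas[OF \<open>u \<in> borel_measurable N\<close>]])
  with add show ?case by simp
next
  case (seq U)
  have "(\<integral>\<^sup>+y. (SUP i. U i) y \<partial>\<kappa> x) = (SUP i. \<integral>\<^sup>+y. U i y \<partial>\<kappa> x)" for x
    unfolding SUP_apply
    by (rule nn_integral_monotone_convergence_SUP[OF \<open>incseq U\<close> meas[OF seq(1)]])
  with seq show ?case by simp
  qed
qed

text \<open>
The integrand may depend on the parameter: push the kernel forward to the graph
\<open>y \<mapsto> (x, y)\<close> and integrate the fixed function \<open>f\<close> there.
\<close>

lemma integral_measurable_kernel:
  fixes f :: "'a \<Rightarrow> 'b \<Rightarrow> real"
  assumes f[measurable]: "(\<lambda>(x, y). f x y) \<in> borel_measurable (M \<Otimes>\<^sub>M N)"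
    and L[measurable]: "L \<in> measurable M (subprob_algebra N)"
  shows "(\<lambda>x. \<integral>y. f x y \<partial>L x) \<in> borel_measurable M"
proof -
  note integral_measurable_subprob_algebra[measurable]
  note measurable_distr2[measurable]
  have "(\<lambda>x. integral\<^sup>L (distr (L x) (M \<Otimes>\<^sub>M N) (\<lambda>y. (x, y))) (\<lambda>(x, y). f x y)) \<in> borel_measurable M"
    by measurable
  then show ?thesis
    by (rule measurable_cong[THEN iffD1, rotated])
       (subst integral_distr, auto simp: measurable_cong_sets[OF sets_kernel[OF L] refl])
qed

lemma set_integral_reflect:
  fixes f :: "real \<Rightarrow> real"
  shows "(LINT r:{0..s}|lborel. f r) = (LINT r:{0..s}|lborel. f (s - r))"
proof -
  have "(LINT r:{0..s}|lborel. f r) = (\<integral>r. indicator {0..s} (s - r) *\<^sub>R f (s - r) \<partial>lborel)"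
    unfolding set_lebesgue_integral_def
    by (subst lborel_integral_real_affine[where c="-1" and t=s]) auto
  also have "\<dots> = (\<integral>r. indicator {0..s} r *\<^sub>R f (s - r) \<partial>lborel)"
    by (intro Bochner_Integration.integral_cong) (auto simp: indicator_def)
  finally show ?thesis by (simp add: set_lebesgue_integral_def)
qed

text \<open>
Approximation strictly from the right by functions with countably many values: along it,
right-continuous functions of \<open>r\<close> are limits of measurable step functions.
\<close>

lemma grid_from_right:
  fixes r :: real
  shows "r < (real_of_int \<lfloor>r * real (Suc n)\<rfloor> + 1) / real (Suc n)"
    and "(\<lambda>n. (real_of_int \<lfloor>r * real (Suc n)\<rfloor> + 1) / real (Suc n)) \<longlonglongrightarrow> r"
proof -
  have lb: "r < (real_of_int \<lfloor>r * real (Suc n)\<rfloor> + 1) / real (Suc n)" for n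
    by (subst pos_less_divide_eq) (auto simp del: of_nat_Suc)
  have ub: "(real_of_int \<lfloor>r * real (Suc n)\<rfloor> + 1) / real (Suc n) \<le> r + inverse (real (Suc n))" for n
  proof -
    have "(real_of_int \<lfloor>r * real (Suc n)\<rfloor> + 1) / real (Suc n) \<le> (r * real (Suc n) + 1) / real (Suc n)"
      by (intro divide_right_mono) auto
    also have "\<dots> = r + inverse (real (Suc n))"
      by (simp add: add_divide_distrib inverse_eq_divide del: of_nat_Suc)
    finally show ?thesis .
  qed
  show "r < (real_of_int \<lfloor>r * real (Suc n)\<rfloor> + 1) / real (Suc n)" by (rule lb)
  show "(\<lambda>n. (real_of_int \<lfloor>r * real (Suc n)\<rfloor> + 1) / real (Suc n)) \<longlonglongrightarrow> r"
  proof (rule tendsto_sandwich[OF _ _ tendsto_const])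
    show "(\<lambda>n. r + inverse (real (Suc n))) \<longlonglongrightarrow> r"
      using tendsto_add[OF tendsto_const LIMSEQ_inverse_real_of_nat, of r] by simp
  qed (use lb ub in \<open>auto intro!: always_eventually less_imp_le simp del: of_nat_Suc\<close>)
qed

section \<open>Jump measures and branching functions\<close>

text \<open>
The quadratic bound follows from \<open>exp (- z) \<le> 1 / (1 + z)\<close>, since
\<open>1 / (1 + z) - 1 + z = z\<^sup>2 / (1 + z)\<close>.
\<close>

lemma exp_remainder_bounds:
  fixes z :: real
  assumes "0 \<le> z"
  shows "0 \<le> exp (- z) - 1 + z" "exp (- z) - 1 + z \<le> z" "exp (- z) - 1 + z \<le> z\<^sup>2"
proof -
  show "0 \<le> exp (- z) - 1 + z" using exp_ge_add_one_self[of "-z"] by simp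
  show "exp (- z) - 1 + z \<le> z" using assms by simp
  have "exp (- z) \<le> 1 / (1 + z)"
    using exp_ge_add_one_self[of z] assms by (simp add: exp_minus field_simps)
  moreover have "1 / (1 + z) - 1 + z = z\<^sup>2 / (1 + z)"
    using assms by (simp add: field_simps power2_eq_square)
  moreover have "z\<^sup>2 / (1 + z) \<le> z\<^sup>2"
    using assms by (simp add: divide_le_eq mult_left_le ) (smt (verit) mult_right_mono mult_le_cancel_left1 zero_le_power2)
  ultimately show "exp (- z) - 1 + z \<le> z\<^sup>2" by linarith
qed

text \<open>
The measures for which the integral in a branching function converges for every \<open>l \<ge> 0\<close>.
\<close>

locale jump_measure =
  fixes \<eta> :: "real measure"
  assumes sets_jump: "sets \<eta> = sets pos_borel"
    and jump_moment: "(\<integral>\<^sup>+y. ennreal (min y (y\<^sup>2)) \<partial>\<eta>) < \<infinity>"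
begin

lemma space_jump: "space \<eta> = {0<..}"
  using sets_eq_imp_space_eq[OF sets_jump] by (simp add: pos_borel_def)

lemma borel_measurable_jump [measurable]:
  assumes "f \<in> borel_measurable borel"
  shows "f \<in> borel_measurable \<eta>"
proof -
  have "f \<in> borel_measurable pos_borel"
    using assms unfolding pos_borel_def by (rule measurable_restrict_space1)
  then show ?thesis using measurable_cong_sets[OF sets_jump refl] by blast
qed

lemma integrable_min: "integrable \<eta> (\<lambda>y. min y (y\<^sup>2))"
proof (rule integrableI_nonneg)
  show "(\<lambda>y. min y (y\<^sup>2)) \<in> borel_measurable \<eta>"
    by (intro borel_measurable_jump) measurable
  show "AE y in \<eta>. 0 \<le> min y (y\<^sup>2)" by (rule AE_I2) (auto simp: space_jump)
qed (use jump_moment in auto)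

lemma remainder_le:
  fixes l y :: real
  assumes "0 \<le> l" "0 < y"
  shows "0 \<le> exp (- l * y) - 1 + l * y" "exp (- l * y) - 1 + l * y \<le> max l (l\<^sup>2) * min y (y\<^sup>2)"
proof -
  have ly: "0 \<le> l * y" using assms by (intro mult_nonneg_nonneg) auto
  note b = exp_remainder_bounds[OF ly]
  show "0 \<le> exp (- l * y) - 1 + l * y" using b(1) by simp
  show "exp (- l * y) - 1 + l * y \<le> max l (l\<^sup>2) * min y (y\<^sup>2)"
  proof (cases "y \<le> y\<^sup>2")
    case True
    have "l * y \<le> max l (l\<^sup>2) * y" using assms by (intro mult_right_mono) auto
    then show ?thesis using True order_trans[OF b(2)] by (simp add: min_absorb1)
  next
    case False
    have "l\<^sup>2 * y\<^sup>2 \<le> max l (l\<^sup>2) * y\<^sup>2" by (intro mult_right_mono) auto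
    then show ?thesis using False b(3) by (simp add: min_absorb2 power_mult_distrib)
  qed
qed

lemma integrable_remainder:
  assumes "0 \<le> l"
  shows "integrable \<eta> (\<lambda>y. exp (- l * y) - 1 + l * y)"
proof (rule Bochner_Integration.integrable_bound)
  show "integrable \<eta> (\<lambda>y. max l (l\<^sup>2) * min y (y\<^sup>2))" using integrable_min by simp
  show "(\<lambda>y. exp (- l * y) - 1 + l * y) \<in> borel_measurable \<eta>"
    by (intro borel_measurable_jump) measurable
  show "AE y in \<eta>. norm (exp (- l * y) - 1 + l * y) \<le> norm (max l (l\<^sup>2) * min y (y\<^sup>2))"
    using remainder_le[OF assms] by (intro AE_I2) (fastforce simp: space_jump)
qed

lemma integral_remainder_bounds:
  assumes "0 \<le> l"
  shows "0 \<le> (\<integral>y. (exp (- l * y) - 1 + l * y) \<partial>\<eta>)"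
    and "(\<integral>y. (exp (- l * y) - 1 + l * y) \<partial>\<eta>) \<le> max l (l\<^sup>2) * (\<integral>y. min y (y\<^sup>2) \<partial>\<eta>)"
proof -
  show "0 \<le> (\<integral>y. (exp (- l * y) - 1 + l * y) \<partial>\<eta>)"
    using remainder_le[OF assms] by (intro integral_nonneg_AE AE_I2) (auto simp: space_jump)
  have "(\<integral>y. (exp (- l * y) - 1 + l * y) \<partial>\<eta>) \<le> (\<integral>y. max l (l\<^sup>2) * min y (y\<^sup>2) \<partial>\<eta>)"
    using remainder_le[OF assms] integrable_remainder[OF assms] integrable_min
    by (intro integral_mono_AE AE_I2) (auto simp: space_jump)
  then show "(\<integral>y. (exp (- l * y) - 1 + l * y) \<partial>\<eta>) \<le> max l (l\<^sup>2) * (\<integral>y. min y (y\<^sup>2) \<partial>\<eta>)"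
    by simp
qed

text \<open>
The integrand \<open>(1 - exp (- l y)) y\<close> is the derivative of \<open>exp (- l y) - 1 + l y\<close> in \<open>l\<close>.
\<close>

lemma integrable_slope:
  assumes "0 \<le> l"
  shows "integrable \<eta> (\<lambda>y. (1 - exp (- l * y)) * y)"
proof (rule Bochner_Integration.integrable_bound)
  show "integrable \<eta> (\<lambda>y. max 1 l * min y (y\<^sup>2))" using integrable_min by simp
  show "(\<lambda>y. (1 - exp (- l * y)) * y) \<in> borel_measurable \<eta>"
    by (intro borel_measurable_jump) measurable
  show "AE y in \<eta>. norm ((1 - exp (- l * y)) * y) \<le> norm (max 1 l * min y (y\<^sup>2))"
  proof (rule AE_I2)
    fix y assume "y \<in> space \<eta>"
    then have y: "0 < y" by (simp add: space_jump)
    have ly: "0 \<le> l * y" using y assms by (intro mult_nonneg_nonneg) auto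
    have 1: "0 \<le> 1 - exp (- l * y)" using ly by simp
    have 2: "1 - exp (- l * y) \<le> max 1 l" "1 - exp (- l * y) \<le> l * y"
      using exp_ge_add_one_self[of "- l * y"] by (auto simp: le_max_iff_disj)
    have "(1 - exp (- l * y)) * y \<le> max 1 l * min y (y\<^sup>2)"
    proof (cases "y \<le> y\<^sup>2")
      case True
      have "(1 - exp (- l * y)) * y \<le> max 1 l * y" using 2 y by (intro mult_right_mono) auto
      then show ?thesis using True by (simp add: min_absorb1)
    next
      case False
      have "(1 - exp (- l * y)) * y \<le> (l * y) * y" using 2 y by (intro mult_right_mono) auto
      also have "\<dots> = l * y\<^sup>2" by (simp add: power2_eq_square)
      also have "\<dots> \<le> max 1 l * y\<^sup>2" by (intro mult_right_mono) auto
      finally show ?thesis using False by (simp add: min_absorb2)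
    qed
    then show "norm ((1 - exp (- l * y)) * y) \<le> norm (max 1 l * min y (y\<^sup>2))"
      using 1 y assms by (simp add: abs_mult)
  qed
qed

text \<open>
Convexity in the form of supporting lines. The slope is the derivative
\<open>- b + 2 a M + \<integral>(1 - exp (- M y)) y \<eta>(dy)\<close>; the inequality holds pointwise under the integral,
because \<open>exp (- l y) = exp (- M y) exp (- (l - M) y) \<ge> exp (- M y) (1 - (l - M) y)\<close>.
\<close>

lemma branching_function_tangent:
  assumes "0 \<le> a" "0 \<le> M"
  obtains p where "\<And>l. 0 \<le> l \<Longrightarrow>
    branching_function b a \<eta> M + p * (l - M) \<le> branching_function b a \<eta> l"
proof
  let ?R = "\<lambda>l y. exp (- l * y) - 1 + l * y"
  let ?I = "\<integral>y. (1 - exp (- M * y)) * y \<partial>\<eta>"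
  fix l :: real assume l: "0 \<le> l"
  have pt: "?R M y + (l - M) * ((1 - exp (- M * y)) * y) \<le> ?R l y" for y
  proof -
    have "exp (- l * y) = exp (- M * y) * exp (- (l - M) * y)"
      by (simp add: exp_add [symmetric] algebra_simps)
    moreover have "exp (- M * y) * (1 + - (l - M) * y) \<le> exp (- M * y) * exp (- (l - M) * y)"
      by (intro mult_left_mono exp_ge_add_one_self) auto
    ultimately have "exp (- M * y) * (1 + - (l - M) * y) \<le> exp (- l * y)" by simp
    then show ?thesis by (simp add: algebra_simps)
  qed
  have "(\<integral>y. ?R M y \<partial>\<eta>) + (l - M) * ?I = (\<integral>y. ?R M y + (l - M) * ((1 - exp (- M * y)) * y) \<partial>\<eta>)"
    using integrable_remainder[OF assms(2)] integrable_slope[OF assms(2)] by simp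
  also have "\<dots> \<le> (\<integral>y. ?R l y \<partial>\<eta>)"
    using integrable_remainder[OF assms(2)] integrable_slope[OF assms(2)] integrable_remainder[OF l] pt
    by (intro integral_mono) auto
  finally have 1: "(\<integral>y. ?R M y \<partial>\<eta>) + (l - M) * ?I \<le> (\<integral>y. ?R l y \<partial>\<eta>)" .
  have "0 \<le> a * (l - M)\<^sup>2" using assms by simp
  then have 2: "a * M\<^sup>2 + 2 * a * M * (l - M) \<le> a * l\<^sup>2"
    by (simp add: power2_eq_square algebra_simps)
  show "branching_function b a \<eta> M + (- b + 2 * a * M + ?I) * (l - M) \<le> branching_function b a \<eta> l"
    using 1 2 unfolding branching_function_def by (simp add: algebra_simps)
qed

text \<open>
The Esscher transform of a branching function is its increment above the level \<open>v\<close>.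
\<close>

lemma branching_function_tilt:
  assumes "0 \<le> v" "0 \<le> l"
  shows "branching_function (b - 2 * a * v - (\<integral>y. (1 - exp (- v * y)) * y \<partial>\<eta>)) a
           (density \<eta> (\<lambda>y. ennreal (exp (- v * y)))) l
         = branching_function b a \<eta> (l + v) - branching_function b a \<eta> v"
proof -
  let ?R = "\<lambda>l y. exp (- l * y) - 1 + l * y"
  have [measurable]: "(\<lambda>y. exp (- v * y)) \<in> borel_measurable \<eta>" "?R l \<in> borel_measurable \<eta>"
    by (intro borel_measurable_jump, measurable)+
  have "(\<integral>y. ?R l y \<partial>density \<eta> (\<lambda>y. ennreal (exp (- v * y)))) = (\<integral>y. exp (- v * y) * ?R l y \<partial>\<eta>)"
    by (subst integral_density) auto
  also have "\<dots> = (\<integral>y. ?R (l + v) y - ?R v y - l * ((1 - exp (- v * y)) * y) \<partial>\<eta>)"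
    by (rule Bochner_Integration.integral_cong) (auto simp: algebra_simps exp_add[symmetric])
  also have "\<dots> = (\<integral>y. ?R (l + v) y - ?R v y \<partial>\<eta>) - (\<integral>y. l * ((1 - exp (- v * y)) * y) \<partial>\<eta>)"
    using assms by (intro Bochner_Integration.integral_diff Bochner_Integration.integrable_diff
      integrable_mult_right integrable_remainder integrable_slope) auto
  also have "(\<integral>y. ?R (l + v) y - ?R v y \<partial>\<eta>) = (\<integral>y. ?R (l + v) y \<partial>\<eta>) - (\<integral>y. ?R v y \<partial>\<eta>)"
    using assms by (intro Bochner_Integration.integral_diff integrable_remainder) auto
  also have "(\<integral>y. l * ((1 - exp (- v * y)) * y) \<partial>\<eta>) = l * (\<integral>y. (1 - exp (- v * y)) * y \<partial>\<eta>)"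
    by (rule integral_mult_right_zero)
  finally show ?thesis
    unfolding branching_function_def by (simp add: algebra_simps power2_eq_square)
qed

end

lemma branching_function_0 [simp]: "branching_function b a \<eta> 0 = 0"
  by (simp add: branching_function_def)

lemma admissible_branching_jump_measure:
  assumes "admissible_branching \<beta> \<alpha> \<pi>"
  shows "jump_measure (\<pi> x)"
proof
  show "sets (\<pi> x) = sets pos_borel" using assms by (simp add: admissible_branching_def)
  have "(\<integral>\<^sup>+y. ennreal (min y (y\<^sup>2)) \<partial>\<pi> x) \<le> (SUP x. \<integral>\<^sup>+y. ennreal (min y (y\<^sup>2)) \<partial>\<pi> x)"
    by (rule SUP_upper) simp
  also have "\<dots> < \<infinity>" using assms by (simp add: admissible_branching_def)
  finally show "(\<integral>\<^sup>+y. ennreal (min y (y\<^sup>2)) \<partial>\<pi> x) < \<infinity>" .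
qed

text \<open>
Continuity in \<open>l\<close> supplies the joint measurability of mechanisms, as they are measurable
in the spatial variable for each fixed \<open>l\<close>.
\<close>

lemma continuous_on_branching_function:
  assumes "jump_measure \<eta>"
  shows "continuous_on {0..} (branching_function b a \<eta>)"
proof -
  interpret jump_measure \<eta> by fact
  have "continuous_on {0..} (\<lambda>l. \<integral>y. (exp (- l * y) - 1 + l * y) \<partial>\<eta>)"
  proof (rule continuous_on_sequentiallyI)
    fix u :: "nat \<Rightarrow> real" and l assume u: "\<forall>n. u n \<in> {0..}" and l: "l \<in> {0..}" and lim: "u \<longlonglongrightarrow> l"
    obtain C where C: "\<And>n. u n \<le> C" "0 \<le> C"
    proof -
      have "Bseq u" using lim by (intro convergent_imp_Bseq convergentI)
      then obtain K where "0 < K" "\<And>n. norm (u n) \<le> K" by (auto simp: Bseq_def)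
      then show ?thesis using that[of K] by (metis abs_le_D1 less_imp_le real_norm_def)
    qed
    show "(\<lambda>n. \<integral>y. (exp (- u n * y) - 1 + u n * y) \<partial>\<eta>) \<longlonglongrightarrow> (\<integral>y. (exp (- l * y) - 1 + l * y) \<partial>\<eta>)"
    proof (rule integral_dominated_convergence)
      show "integrable \<eta> (\<lambda>y. max C (C\<^sup>2) * min y (y\<^sup>2))" using integrable_min by simp
      show "AE y in \<eta>. (\<lambda>n. exp (- u n * y) - 1 + u n * y) \<longlonglongrightarrow> exp (- l * y) - 1 + l * y"
        using lim by (intro AE_I2 tendsto_intros)
      show "AE y in \<eta>. norm (exp (- u n * y) - 1 + u n * y) \<le> max C (C\<^sup>2) * min y (y\<^sup>2)" for n
      proof (rule AE_I2)
        fix y assume "y \<in> space \<eta>"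
        then have y: "0 < y" by (simp add: space_jump)
        have "max (u n) ((u n)\<^sup>2) * min y (y\<^sup>2) \<le> max C (C\<^sup>2) * min y (y\<^sup>2)"
          using C u y by (intro mult_right_mono max.mono power_mono) auto
        then show "norm (exp (- u n * y) - 1 + u n * y) \<le> max C (C\<^sup>2) * min y (y\<^sup>2)"
          using order_trans[OF remainder_le(2)[of "u n" y]] remainder_le(1)[of "u n" y] u y by simp
      qed
    qed (intro borel_measurable_jump, measurable)+
  qed
  then show ?thesis
    unfolding branching_function_def by (intro continuous_intros) auto
qed

text \<open>
The two properties of a branching mechanism used by the mild equation: the nonlinearity
\<open>\<psi>(y, u\<^sub>s(y))\<close> is jointly measurable and locally bounded whenever \<open>u\<close> is. The truncation \<open>max 0 l\<close>
confines the requirement to the half-line on which mechanisms are given.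
\<close>

definition borel_mechanism :: "('a::topological_space \<Rightarrow> real \<Rightarrow> real) \<Rightarrow> bool" where
  "borel_mechanism \<psi> \<longleftrightarrow>
     (\<lambda>(x, l). \<psi> x (max 0 l)) \<in> borel_measurable (borel \<Otimes>\<^sub>M borel) \<and>
     (\<forall>C. \<exists>B. \<forall>x. \<forall>l\<in>{0..C}. \<bar>\<psi> x l\<bar> \<le> B)"

lemma borel_mechanism_branching:
  assumes adm: "admissible_branching \<beta> \<alpha> \<pi>"
  shows "borel_mechanism (branching_mechanism \<beta> \<alpha> \<pi>)"
proof -
  note J = admissible_branching_jump_measure[OF adm]
  have [measurable]: "\<beta> \<in> borel_measurable borel" "\<alpha> \<in> borel_measurable borel"
    using adm by (auto simp: admissible_branching_def bounded_borel_nonneg_def bounded_borel_def)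
  let ?\<psi> = "branching_mechanism \<beta> \<alpha> \<pi>"
  let ?R = "\<lambda>l y. exp (- l * y) - 1 + l * (y::real)"
  have ptm: "(\<lambda>x. ?\<psi> x l) \<in> borel_measurable borel" if l: "0 \<le> l" for l
  proof -
    have "(\<lambda>x. \<integral>\<^sup>+y. ennreal (?R l y) \<partial>\<pi> x) \<in> borel_measurable borel"
    proof (rule measurable_nn_integral_kernel[where N=pos_borel])
      show "(\<lambda>y. ennreal (?R l y)) \<in> borel_measurable pos_borel"
        unfolding pos_borel_def by (intro measurable_restrict_space1) measurable
    qed (use adm in \<open>auto simp: admissible_branching_def\<close>)
    moreover have "(\<integral>y. ?R l y \<partial>\<pi> x) = enn2real (\<integral>\<^sup>+y. ennreal (?R l y) \<partial>\<pi> x)" for x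
    proof -
      interpret jump_measure "\<pi> x" by (rule J)
      have "AE y in \<pi> x. 0 \<le> ?R l y"
        using remainder_le(1)[OF l] by (intro AE_I2) (auto simp: space_jump)
      moreover have "?R l \<in> borel_measurable (\<pi> x)" by (intro borel_measurable_jump) measurable
      ultimately show ?thesis by (rule integral_eq_nn_integral[rotated])
    qed
    ultimately have [measurable]: "(\<lambda>x. \<integral>y. ?R l y \<partial>\<pi> x) \<in> borel_measurable borel" by simp
    show ?thesis
      unfolding branching_mechanism_def branching_function_def by measurable
  qed
  define d :: "nat \<Rightarrow> int \<Rightarrow> real" where "d n i = (real_of_int i + 1) / real (Suc n)" for n i
  have "(\<lambda>w. ?\<psi> (fst w) (max 0 (snd w))) \<in> borel_measurable (borel \<Otimes>\<^sub>M borel)"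
  proof (rule borel_measurable_LIMSEQ_real)
    fix n :: nat
    have step: "(\<lambda>w. ?\<psi> (fst w) (max 0 (d n i))) \<in> borel_measurable (borel \<Otimes>\<^sub>M (borel :: real measure))" for i
      by (rule measurable_compose[OF measurable_fst ptm]) simp
    show "(\<lambda>w. ?\<psi> (fst w) (max 0 (d n \<lfloor>snd w * real (Suc n)\<rfloor>))) \<in> borel_measurable (borel \<Otimes>\<^sub>M borel)"
      by (rule measurable_compose_countable[OF step]) measurable
  next
    fix w :: "'a \<times> real"
    have "(\<lambda>n. d n \<lfloor>snd w * real (Suc n)\<rfloor>) \<longlonglongrightarrow> snd w"
      unfolding d_def by (rule grid_from_right)
    then have "(\<lambda>n. max 0 (d n \<lfloor>snd w * real (Suc n)\<rfloor>)) \<longlonglongrightarrow> max 0 (snd w)"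
      by (intro tendsto_max tendsto_const)
    then show "(\<lambda>n. ?\<psi> (fst w) (max 0 (d n \<lfloor>snd w * real (Suc n)\<rfloor>))) \<longlonglongrightarrow> ?\<psi> (fst w) (max 0 (snd w))"
      unfolding branching_mechanism_def
      by (rule continuous_on_tendsto_compose[OF continuous_on_branching_function[OF J]]) (auto simp del: of_nat_Suc)
  qed
  then have "(\<lambda>(x, l). ?\<psi> x (max 0 l)) \<in> borel_measurable (borel \<Otimes>\<^sub>M borel)"
    by (simp add: split_beta')
  moreover have "\<exists>B. \<forall>x. \<forall>l\<in>{0..C}. \<bar>?\<psi> x l\<bar> \<le> B" for C
  proof -
    have "\<beta> \<in> bounded_borel" "\<alpha> \<in> bounded_borel"
      using adm by (simp_all add: admissible_branching_def bounded_borel_nonneg_def)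
    then obtain B1 B2 where B1: "\<And>x. \<bar>\<beta> x\<bar> \<le> B1" and B2: "\<And>x. \<bar>\<alpha> x\<bar> \<le> B2"
      by (meson bounded_borelE)
    let ?S = "SUP x. \<integral>\<^sup>+y. ennreal (min y (y\<^sup>2)) \<partial>\<pi> x"
    have fin: "?S < \<infinity>" using adm by (simp add: admissible_branching_def)
    have m: "(\<integral>y. min y (y\<^sup>2) \<partial>\<pi> x) \<le> enn2real ?S" for x
    proof -
      interpret jump_measure "\<pi> x" by (rule J)
      have "(\<integral>y. min y (y\<^sup>2) \<partial>\<pi> x) = enn2real (\<integral>\<^sup>+y. ennreal (min y (y\<^sup>2)) \<partial>\<pi> x)"
        using integrable_min by (intro integral_eq_nn_integral AE_I2) (auto simp: space_jump)
      also have "\<dots> \<le> enn2real ?S"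
        using fin by (intro enn2real_mono SUP_upper) auto
      finally show ?thesis .
    qed
    show ?thesis
    proof (intro exI allI ballI)
      fix x l assume l: "l \<in> {0..C}"
      interpret jump_measure "\<pi> x" by (rule J)
      have "\<bar>\<beta> x * l\<bar> \<le> B1 * C" unfolding abs_mult using B1[of x] l by (intro mult_mono) auto
      moreover have "\<bar>\<alpha> x * l\<^sup>2\<bar> \<le> B2 * C\<^sup>2"
        unfolding abs_mult using B2[of x] l by (intro mult_mono) (auto intro: power_mono)
      moreover have "(\<integral>y. ?R l y \<partial>\<pi> x) \<le> max C (C\<^sup>2) * enn2real ?S"
      proof (rule order_trans[OF integral_remainder_bounds(2)])
        show "max l (l\<^sup>2) * (\<integral>y. min y (y\<^sup>2) \<partial>\<pi> x) \<le> max C (C\<^sup>2) * enn2real ?S"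
        proof (rule mult_mono)
          show "max l (l\<^sup>2) \<le> max C (C\<^sup>2)" using l by (intro max.mono power_mono) auto
          show "0 \<le> (\<integral>y. min y (y\<^sup>2) \<partial>\<pi> x)"
            by (intro integral_nonneg_AE AE_I2) (auto simp: space_jump)
          show "0 \<le> max C (C\<^sup>2)" using l by (simp add: le_max_iff_disj)
        qed (rule m)
      qed (use l in auto)
      moreover have "0 \<le> (\<integral>y. ?R l y \<partial>\<pi> x)" using l by (intro integral_remainder_bounds) auto
      ultimately show "\<bar>?\<psi> x l\<bar> \<le> B1 * C + B2 * C\<^sup>2 + max C (C\<^sup>2) * enn2real ?S"
        unfolding branching_mechanism_def branching_function_def by linarith
    qed
  qed
  ultimately show ?thesis by (simp add: borel_mechanism_def)
qed

lemma star_branching_mechanism_eq: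
  assumes adm: "admissible_branching \<beta> \<alpha> \<pi>" and "0 \<le> w x" "0 \<le> l"
  shows "star_branching_mechanism \<beta> \<alpha> \<pi> w x l
    = branching_mechanism \<beta> \<alpha> \<pi> x (l + w x) - branching_mechanism \<beta> \<alpha> \<pi> x (w x)"
  using jump_measure.branching_function_tilt[OF admissible_branching_jump_measure[OF adm, of x] assms(2,3)]
  by (simp add: star_branching_mechanism_def branching_mechanism_def beta_star_def pi_star_def)

section \<open>Sub-Markov semigroups\<close>

text \<open>
A measurable sub-Markov semigroup \<open>P\<close> together with a kernel \<open>\<kappa>\<close> representing it. The operators and the
kernel are separate parameters because \<open>P\<close> enters the mild equation as given, whereas \<open>\<kappa>\<close>
is a family indexed by all real times, which keeps measurability statements free of side conditions
on the time.
\<close>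

locale submarkov_semigroup =
  fixes P :: "real \<Rightarrow> ('a::topological_space \<Rightarrow> real) \<Rightarrow> 'a \<Rightarrow> real"
    and \<kappa> :: "real \<Rightarrow> 'a \<Rightarrow> 'a measure"
  assumes kernel_measurable:
      "(\<lambda>(t, x). \<kappa> t x) \<in> borel \<Otimes>\<^sub>M borel \<rightarrow>\<^sub>M subprob_algebra borel"
    and semigroup_eq_kernel: "0 \<le> t \<Longrightarrow> f \<in> bounded_borel \<Longrightarrow> P t f x = (\<integral>y. f y \<partial>\<kappa> t x)"
    and semigroup_0: "f \<in> bounded_borel \<Longrightarrow> P 0 f x = f x"
    and semigroup_add: "0 \<le> s \<Longrightarrow> 0 \<le> t \<Longrightarrow> f \<in> bounded_borel \<Longrightarrow> P s (P t f) x = P (s + t) f x"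

context submarkov_semigroup
begin

lemma kernel_space: "subprob_space (\<kappa> t x)" "sets (\<kappa> t x) = sets borel"
  using measurable_space[OF kernel_measurable, of "(t, x)"] by (auto simp: space_subprob_algebra space_pair_measure)

lemma finite_measure_kernel: "finite_measure (\<kappa> t x)"
  using kernel_space(1) by (rule subprob_space.axioms(1))

lemma space_kernel: "space (\<kappa> t x) = UNIV"
  using sets_eq_imp_space_eq[OF kernel_space(2)] by simp

lemma measurable_kernel [simp]: "f \<in> borel_measurable (\<kappa> t x) \<longleftrightarrow> f \<in> borel_measurable borel"
  using measurable_cong_sets[OF kernel_space(2) refl] by blast

lemma integrable_kernel:
  assumes "f \<in> bounded_borel"
  shows "integrable (\<kappa> t x) f"
proof -
  obtain B where "f \<in> borel_measurable borel" "\<And>x. \<bar>f x\<bar> \<le> B" using assms by (meson bounded_borelE)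
  then show ?thesis
    by (intro finite_measure.integrable_const_bound[OF finite_measure_kernel, where B=B]) auto
qed

lemma integral_kernel_const_le: "0 \<le> (c :: real) \<Longrightarrow> (\<integral>y. c \<partial>\<kappa> t x) \<le> c"
  using mult_left_le_one_le[of c "measure (\<kappa> t x) UNIV"] subprob_space.subprob_measure_le_1[OF kernel_space(1)[of t x], of UNIV]
  by (simp add: space_kernel)

lemma abs_integral_kernel_le:
  fixes f :: "'a \<Rightarrow> real"
  assumes "f \<in> borel_measurable borel" "\<And>x. \<bar>f x\<bar> \<le> B"
  shows "\<bar>\<integral>y. f y \<partial>\<kappa> t x\<bar> \<le> B"
proof -
  have f: "integrable (\<kappa> t x) f" by (rule integrable_kernel[OF bounded_borelI[OF assms]])
  have "0 \<le> B" using assms(2)[of x] by linarith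
  have "\<bar>\<integral>y. f y \<partial>\<kappa> t x\<bar> \<le> (\<integral>y. \<bar>f y\<bar> \<partial>\<kappa> t x)" by (rule integral_abs_bound)
  also have "\<dots> \<le> (\<integral>y. B \<partial>\<kappa> t x)"
    using f assms finite_measure.integrable_const[OF finite_measure_kernel] by (intro integral_mono) auto
  also have "\<dots> \<le> B" by (rule integral_kernel_const_le) fact
  finally show ?thesis .
qed

lemma measurable_shifted_kernel:
  fixes h :: "real \<Rightarrow> 'a \<Rightarrow> real"
  assumes h: "(\<lambda>(r, y). h r y) \<in> borel_measurable (borel \<Otimes>\<^sub>M borel)"
  shows "(\<lambda>(r, y). \<integral>z. h r z \<partial>\<kappa> (c - r) y) \<in> borel_measurable (borel \<Otimes>\<^sub>M borel)"
proof -
  have "(\<lambda>w. (c - fst w, snd w)) \<in> borel \<Otimes>\<^sub>M borel \<rightarrow>\<^sub>M borel \<Otimes>\<^sub>M borel" by measurable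
  then have K: "(\<lambda>w. \<kappa> (c - fst w) (snd w)) \<in> borel \<Otimes>\<^sub>M borel \<rightarrow>\<^sub>M subprob_algebra borel"
    using measurable_compose[OF _ kernel_measurable, of "\<lambda>w. (c - fst w, snd w)"] by simp
  have "(\<lambda>w :: (real \<times> 'a) \<times> 'a. (fst (fst w), snd w)) \<in> (borel \<Otimes>\<^sub>M borel) \<Otimes>\<^sub>M borel \<rightarrow>\<^sub>M borel \<Otimes>\<^sub>M borel" by measurable
  then have "(\<lambda>w :: (real \<times> 'a) \<times> 'a. h (fst (fst w)) (snd w)) \<in> borel_measurable ((borel \<Otimes>\<^sub>M borel) \<Otimes>\<^sub>M borel)"
    using measurable_compose[OF _ h, of "\<lambda>w :: (real \<times> 'a) \<times> 'a. (fst (fst w), snd w)"] by simp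
  then have "(\<lambda>w. \<integral>z. h (fst w) z \<partial>\<kappa> (c - fst w) (snd w)) \<in> borel_measurable (borel \<Otimes>\<^sub>M borel)"
    by (intro integral_measurable_kernel[OF _ K]) (simp add: split_beta')
  then show ?thesis by (simp add: split_beta')
qed

text \<open>
Interchange of the semigroup with an integral over time, on a bounded time interval.
\<close>

lemma kernel_time_fubini:
  fixes h :: "real \<Rightarrow> 'a \<Rightarrow> real"
  assumes h: "(\<lambda>(r, y). h r y) \<in> borel_measurable (borel \<Otimes>\<^sub>M borel)" and B: "\<And>r y. \<bar>h r y\<bar> \<le> B"
  shows "(\<integral>y. (LINT r:{0..s}|lborel. h r y) \<partial>\<kappa> t x) = (LINT r:{0..s}|lborel. (\<integral>y. h r y \<partial>\<kappa> t x))"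
proof -
  interpret K: subprob_space "\<kappa> t x" by (rule kernel_space)
  interpret pair_sigma_finite lborel "\<kappa> t x" ..
  let ?f = "\<lambda>(r, y). indicator {0..s} r *\<^sub>R h r y"
  have sets: "sets (lborel \<Otimes>\<^sub>M \<kappa> t x) = sets (borel \<Otimes>\<^sub>M borel)"
    by (intro sets_pair_measure_cong) (auto simp: kernel_space)
  have m: "?f \<in> borel_measurable (lborel \<Otimes>\<^sub>M \<kappa> t x)"
  proof -
    have [measurable]: "(\<lambda>w. h (fst w) (snd w)) \<in> borel_measurable (borel \<Otimes>\<^sub>M borel)"
      using h by (simp add: split_beta')
    have [measurable]: "{0..s} \<in> sets borel" by simp
    have "(\<lambda>w. indicator {0..s} (fst w) *\<^sub>R h (fst w) (snd w)) \<in> borel_measurable (borel \<Otimes>\<^sub>M borel)"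
      by (intro borel_measurable_scaleR measurable_compose[OF measurable_fst borel_measurable_indicator]) measurable
    then show ?thesis unfolding measurable_cong_sets[OF sets refl] by (simp add: split_beta')
  qed
  have "integrable (lborel \<Otimes>\<^sub>M \<kappa> t x) ?f"
  proof (rule integrableI_bounded_set[OF _ m, where A="{0..s} \<times> UNIV" and B=B])
    show "{0..s} \<times> UNIV \<in> sets (lborel \<Otimes>\<^sub>M \<kappa> t x)" unfolding sets by auto
    have "emeasure (lborel \<Otimes>\<^sub>M \<kappa> t x) ({0..s} \<times> space (\<kappa> t x)) = emeasure lborel {0..s} * emeasure (\<kappa> t x) (space (\<kappa> t x))"
      by (rule K.emeasure_pair_measure_Times) auto
    also have "\<dots> < \<infinity>"
      using le_less_trans[OF K.emeasure_space_le_1, of top]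
      by (simp add: ennreal_mult_less_top emeasure_lborel_Icc_eq)
    finally show "emeasure (lborel \<Otimes>\<^sub>M \<kappa> t x) ({0..s} \<times> UNIV) < \<infinity>" by (simp add: space_kernel)
    show "AE w in lborel \<Otimes>\<^sub>M \<kappa> t x. w \<in> {0..s} \<times> UNIV \<longrightarrow> norm (?f w) \<le> B"
      using B by (intro AE_I2) auto
  qed (auto intro!: AE_I2 simp: indicator_def)
  then have "(\<integral>y. (\<integral>r. indicator {0..s} r *\<^sub>R h r y \<partial>lborel) \<partial>\<kappa> t x) = (\<integral>r. (\<integral>y. indicator {0..s} r *\<^sub>R h r y \<partial>\<kappa> t x) \<partial>lborel)"
    by (rule Fubini_integral)
  then show ?thesis by (simp add: set_lebesgue_integral_def)
qed

end

text \<open>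
The regularity part of the notion of a mild solution, without the equation. It is shared by all the
functions obtained from a solution by adding or subtracting a fixed function.
\<close>

definition bounded_evolution :: "(real \<Rightarrow> 'a::topological_space \<Rightarrow> real) \<Rightarrow> bool" where
  "bounded_evolution u \<longleftrightarrow>
     (\<lambda>(t, x). u t x) \<in> borel_measurable (restrict_space borel {0..} \<Otimes>\<^sub>M borel) \<and>
     (\<forall>t\<ge>0. \<forall>x. 0 \<le> u t x) \<and> (\<forall>T\<ge>0. \<exists>C. \<forall>t\<in>{0..T}. \<forall>x. u t x \<le> C)"

lemma mild_solution_iff:
  "mild_solution P \<psi> f u \<longleftrightarrow> bounded_evolution u \<and>
     (\<forall>t\<ge>0. \<forall>x. u t x = P t f x - (LINT s:{0..t}|lborel. P s (\<lambda>y. \<psi> y (u (t - s) y)) x))"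
  unfolding mild_solution_def bounded_evolution_def by blast

lemma bounded_evolutionD:
  assumes "bounded_evolution u"
  shows "(\<lambda>(t, x). u t x) \<in> borel_measurable (restrict_space borel {0..} \<Otimes>\<^sub>M borel)"
    and "0 \<le> t \<Longrightarrow> 0 \<le> u t x"
    and "0 \<le> T \<Longrightarrow> \<exists>C. \<forall>t\<in>{0..T}. \<forall>x. u t x \<le> C"
  using assms unfolding bounded_evolution_def by blast+

lemma mild_solution_evolution: "mild_solution P \<psi> f u \<Longrightarrow> bounded_evolution u"
  by (simp add: mild_solution_iff)

lemma borel_measurable_frozen_time:
  fixes u :: "real \<Rightarrow> 'a::topological_space \<Rightarrow> real"
  assumes "(\<lambda>(t, x). u t x) \<in> borel_measurable (restrict_space borel {0..} \<Otimes>\<^sub>M borel)" "0 \<le> t"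
  shows "(\<lambda>(r, y). u (max 0 (min t r)) y) \<in> borel_measurable (borel \<Otimes>\<^sub>M borel)"
proof -
  have "(\<lambda>r. max 0 (min t r)) \<in> borel \<rightarrow>\<^sub>M restrict_space borel {0..}"
    by (rule measurable_restrict_space2) auto
  then have "(\<lambda>w. (max 0 (min t (fst w)), snd w)) \<in> borel \<Otimes>\<^sub>M borel \<rightarrow>\<^sub>M restrict_space borel {0..} \<Otimes>\<^sub>M borel"
    by (intro measurable_Pair measurable_compose[OF measurable_fst]) auto
  from measurable_compose[OF this assms(1)] show ?thesis by (simp add: split_beta')
qed

text \<open>
Up to time \<open>t\<close> the nonlinearity coincides with a function \<open>h\<close> that is measurable and bounded at all
times; \<open>h\<close> is obtained by freezing \<open>u\<close> outside the interval from \<open>0\<close> to \<open>t\<close>.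
\<close>

lemma bounded_evolution_integrand:
  assumes \<psi>: "borel_mechanism \<psi>" and u: "bounded_evolution u" and "0 \<le> t"
  obtains h B where "(\<lambda>(r, y). h r y) \<in> borel_measurable (borel \<Otimes>\<^sub>M borel)" "\<And>r y. \<bar>h r y\<bar> \<le> B"
    "\<And>r. 0 \<le> r \<Longrightarrow> r \<le> t \<Longrightarrow> h r = (\<lambda>y. \<psi> y (u r y))"
proof -
  define v where "v r = u (max 0 (min t r))" for r
  obtain C where C: "\<And>s y. 0 \<le> s \<Longrightarrow> s \<le> t \<Longrightarrow> u s y \<le> C"
    using bounded_evolutionD(3)[OF u \<open>0 \<le> t\<close>] by (metis atLeastAtMost_iff)
  have v: "0 \<le> v r y" "v r y \<le> C" for r y
    using bounded_evolutionD(2)[OF u, of "max 0 (min t r)" y] C[of "max 0 (min t r)" y] \<open>0 \<le> t\<close> by (auto simp: v_def)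
  obtain B where B: "\<And>x l. l \<in> {0..C} \<Longrightarrow> \<bar>\<psi> x l\<bar> \<le> B" using \<psi> unfolding borel_mechanism_def by metis
  have vm: "(\<lambda>w. v (fst w) (snd w)) \<in> borel_measurable (borel \<Otimes>\<^sub>M borel)"
    using borel_measurable_frozen_time[OF bounded_evolutionD(1)[OF u] \<open>0 \<le> t\<close>] by (simp add: v_def split_beta')
  have "(\<lambda>w. (snd w, v (fst w) (snd w))) \<in> borel \<Otimes>\<^sub>M borel \<rightarrow>\<^sub>M borel \<Otimes>\<^sub>M borel"
    by (intro measurable_Pair vm) auto
  then have "(\<lambda>w. \<psi> (snd w) (max 0 (v (fst w) (snd w)))) \<in> borel_measurable (borel \<Otimes>\<^sub>M borel)"
    using measurable_compose[of "\<lambda>w. (snd w, v (fst w) (snd w))" _ _ "\<lambda>(x, l). \<psi> x (max 0 l)"] \<psi>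
    by (simp add: borel_mechanism_def)
  then have "(\<lambda>(r, y). \<psi> y (v r y)) \<in> borel_measurable (borel \<Otimes>\<^sub>M borel)"
    using v by (simp add: split_beta' max_absorb2)
  then show ?thesis
  proof (rule that[of "\<lambda>r y. \<psi> y (v r y)" B])
    show "\<bar>\<psi> y (v r y)\<bar> \<le> B" for r y using B[of "v r y" y] v[of r y] by simp
  qed (auto simp: v_def max_absorb2 min_absorb2)
qed

lemma bounded_evolution_bounded_borel:
  assumes "bounded_evolution u" "0 \<le> t"
  shows "u t \<in> bounded_borel"
proof -
  obtain C where C: "\<And>y. u t y \<le> C"
    using bounded_evolutionD(3)[OF assms] \<open>0 \<le> t\<close> by (metis atLeastAtMost_iff order_refl)
  have "(\<lambda>(r, y). u (max 0 (min t r)) y) \<in> borel_measurable (borel \<Otimes>\<^sub>M borel)"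
    by (rule borel_measurable_frozen_time[OF bounded_evolutionD(1)[OF assms(1)] assms(2)])
  from measurable_section(1)[OF this, of t] have "u t \<in> borel_measurable borel"
    using \<open>0 \<le> t\<close> by (simp add: max_absorb2)
  then show ?thesis
    using C bounded_evolutionD(2)[OF assms] by (intro bounded_borelI[of _ C]) simp_all
qed

context submarkov_semigroup
begin

lemma semigroup_mono:
  assumes "0 \<le> t" "f \<in> bounded_borel" "g \<in> bounded_borel" "\<And>x. f x \<le> g x"
  shows "P t f x \<le> P t g x"
  using assms by (simp add: semigroup_eq_kernel integral_mono integrable_kernel)

lemma semigroup_diff:
  assumes "0 \<le> t" "f \<in> bounded_borel" "g \<in> bounded_borel"
  shows "P t (\<lambda>x. f x - g x) x = P t f x - P t g x"
  using assms by (simp add: semigroup_eq_kernel bounded_borel_diff integrable_kernel)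

lemma semigroup_cmult:
  assumes "0 \<le> t" "f \<in> bounded_borel"
  shows "P t (\<lambda>x. c * f x) x = c * P t f x"
  using assms by (simp add: semigroup_eq_kernel bounded_borel_cmult)

lemma semigroup_const_le:
  assumes "0 \<le> t" "0 \<le> c"
  shows "P t (\<lambda>x. c) x \<le> c"
  using assms integral_kernel_const_le by (simp only: semigroup_eq_kernel bounded_borel_const)

lemma semigroup_bounded_borel:
  assumes "0 \<le> t" "f \<in> bounded_borel"
  shows "P t f \<in> bounded_borel"
proof -
  obtain C where C: "f \<in> borel_measurable borel" "\<And>y. \<bar>f y\<bar> \<le> C" using assms by (meson bounded_borelE)
  have "(\<lambda>(r :: real, y :: 'a). f y) \<in> borel_measurable (borel \<Otimes>\<^sub>M borel)"
    using measurable_compose[OF measurable_snd C(1)] by (simp add: split_beta')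
  from measurable_section(1)[OF measurable_shifted_kernel[OF this, of t], of 0]
  have "(\<lambda>y. \<integral>z. f z \<partial>\<kappa> t y) \<in> borel_measurable borel" by simp
  then have "(\<lambda>y. \<integral>z. f z \<partial>\<kappa> t y) \<in> bounded_borel"
    using abs_integral_kernel_le[OF C] by (rule bounded_borelI)
  moreover have "P t f = (\<lambda>y. \<integral>z. f z \<partial>\<kappa> t y)"
    using semigroup_eq_kernel[OF assms] by auto
  ultimately show ?thesis by simp
qed

text \<open>
Along \<open>s \<mapsto> P\<^sub>t\<^sub>-\<^sub>s(u\<^sub>s)(x)\<close> the semigroup disappears from the mild equation: applying \<open>P\<^sub>t\<^sub>-\<^sub>s\<close> to the
equation at time \<open>s\<close> and combining \<open>P\<^sub>t\<^sub>-\<^sub>s P\<^sub>s\<^sub>-\<^sub>r = P\<^sub>t\<^sub>-\<^sub>r\<close> leaves an integral whose integrand \<open>g\<close> does not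
depend on \<open>s\<close>.
\<close>

lemma mild_solution_flow:
  assumes \<psi>: "borel_mechanism \<psi>" and f: "f \<in> bounded_borel" and u: "mild_solution P \<psi> f u" and t: "0 \<le> t"
  obtains g B where "g \<in> borel_measurable borel" "\<And>r. \<bar>g r\<bar> \<le> B"
    "\<And>r. 0 \<le> r \<Longrightarrow> r \<le> t \<Longrightarrow> (\<lambda>y. \<psi> y (u r y)) \<in> bounded_borel"
    "\<And>r. 0 \<le> r \<Longrightarrow> r \<le> t \<Longrightarrow> g r = P (t - r) (\<lambda>y. \<psi> y (u r y)) x"
    "\<And>s. 0 \<le> s \<Longrightarrow> s \<le> t \<Longrightarrow> P (t - s) (u s) x = P t f x - (LINT r:{0..s}|lborel. g r)"
proof -
  obtain h B where hm: "(\<lambda>(r, y). h r y) \<in> borel_measurable (borel \<Otimes>\<^sub>M borel)" and B: "\<And>r y. \<bar>h r y\<bar> \<le> B"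
    and h: "\<And>r. 0 \<le> r \<Longrightarrow> r \<le> t \<Longrightarrow> h r = (\<lambda>y. \<psi> y (u r y))"
    using bounded_evolution_integrand[OF \<psi> mild_solution_evolution[OF u] t] by blast
  have hb: "h r \<in> bounded_borel" for r using measurable_section(1)[OF hm] B by (rule bounded_borelI)
  define G where "G s r y = (\<integral>z. h r z \<partial>\<kappa> (s - r) y)" for s r y
  have Gm: "(\<lambda>(r, y). G s r y) \<in> borel_measurable (borel \<Otimes>\<^sub>M borel)" for s
    unfolding G_def by (rule measurable_shifted_kernel[OF hm])
  have GB: "\<bar>G s r y\<bar> \<le> B" for s r y
    unfolding G_def using measurable_section(1)[OF hm] B by (rule abs_integral_kernel_le)
  have G: "G s r y = P (s - r) (h r) y" if "r \<le> s" for s r y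
    using that hb by (simp add: G_def semigroup_eq_kernel)
  have eq: "u s y = P s f y - (LINT r:{0..s}|lborel. G s r y)" if "0 \<le> s" "s \<le> t" for s y
  proof -
    have "u s y = P s f y - (LINT r:{0..s}|lborel. P r (\<lambda>z. \<psi> z (u (s - r) z)) y)"
      using u that(1) unfolding mild_solution_iff by blast
    also have "(LINT r:{0..s}|lborel. P r (\<lambda>z. \<psi> z (u (s - r) z)) y)
        = (LINT r:{0..s}|lborel. P (s - r) (\<lambda>z. \<psi> z (u (s - (s - r)) z)) y)"
      by (rule set_integral_reflect)
    also have "\<dots> = (LINT r:{0..s}|lborel. G s r y)"
      using that by (intro set_lebesgue_integral_cong) (auto simp: G h)
    finally show ?thesis .
  qed
  have int_bb: "(\<lambda>y. LINT r:{0..s}|lborel. G s r y) \<in> bounded_borel" if "0 \<le> s" "s \<le> t" for s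
  proof -
    have "(\<lambda>y. P s f y - u s y) \<in> bounded_borel"
      using f that by (intro bounded_borel_diff semigroup_bounded_borel bounded_evolution_bounded_borel[OF mild_solution_evolution[OF u]])
    then show ?thesis using eq that by simp
  qed
  show ?thesis
  proof (rule that[of "\<lambda>r. G t r x" B])
    show "(\<lambda>r. G t r x) \<in> borel_measurable borel" by (rule measurable_section(2)[OF Gm])
    show "(\<lambda>y. \<psi> y (u r y)) \<in> bounded_borel" if "0 \<le> r" "r \<le> t" for r using hb[of r] h that by simp
    show "G t r x = P (t - r) (\<lambda>y. \<psi> y (u r y)) x" if "0 \<le> r" "r \<le> t" for r using h that by (simp add: G)
    fix s assume s: "0 \<le> s" "s \<le> t"
    let ?I = "\<lambda>y. LINT r:{0..s}|lborel. G s r y"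
    have "u s = (\<lambda>y. P s f y - ?I y)" using eq s by auto
    then have "P (t - s) (u s) x = P (t - s) (P s f) x - P (t - s) ?I x"
      using semigroup_diff[OF _ semigroup_bounded_borel[OF s(1) f] int_bb[OF s], of "t - s" x] s by simp
    also have "P (t - s) (P s f) x = P t f x" using semigroup_add[of "t - s" s f x] s f by simp
    also have "P (t - s) ?I x = (\<integral>y. ?I y \<partial>\<kappa> (t - s) x)"
      using s int_bb by (intro semigroup_eq_kernel) auto
    also have "\<dots> = (LINT r:{0..s}|lborel. (\<integral>y. G s r y \<partial>\<kappa> (t - s) x))"
      by (rule kernel_time_fubini[OF Gm GB])
    also have "\<dots> = (LINT r:{0..s}|lborel. G t r x)"
    proof (intro set_lebesgue_integral_cong allI impI)
      fix r assume "r \<in> {0..s}"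
      then have r: "r \<le> s" by simp
      have "(\<integral>y. G s r y \<partial>\<kappa> (t - s) x) = (\<integral>y. P (s - r) (h r) y \<partial>\<kappa> (t - s) x)"
        by (simp add: G[OF r])
      also have "\<dots> = P (t - s) (P (s - r) (h r)) x"
        using s r by (intro semigroup_eq_kernel[symmetric] semigroup_bounded_borel hb) auto
      also have "\<dots> = P (t - r) (h r) x" using semigroup_add[of "t - s" "s - r" "h r" x] s r hb by simp
      also have "\<dots> = G t r x" using s r by (simp add: G)
      finally show "(\<integral>y. G s r y \<partial>\<kappa> (t - s) x) = G t r x" .
    qed auto
    finally show "P (t - s) (u s) x = P t f x - (LINT r:{0..s}|lborel. G t r x)" .
  qed (rule GB)
qed

end

section \<open>The semigroup of a Borel right process\<close>

lemma sets_borel_of: "sets (borel_of T) = sigma_sets (topspace T) {U. openin T U}"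
  unfolding borel_of_def by (rule sets_measure_of) (auto dest: openin_subset)

lemma space_borel_of [simp]: "space (borel_of T) = topspace T"
  unfolding borel_of_def by (rule space_measure_of) (auto dest: openin_subset)

lemma borel_of_openin: "openin T U \<Longrightarrow> U \<in> sets (borel_of T)"
  by (simp add: sets_borel_of)

abbreviation cemetery_algebra :: "'a::topological_space option measure" where
  "cemetery_algebra \<equiv> borel_of (cemetery_topology euclidean)"

lemma topspace_cemetery [simp]: "topspace (cemetery_topology (euclidean :: 'a::topological_space topology)) = UNIV"
proof -
  have "openin (cemetery_topology (euclidean :: 'a topology)) UNIV" by simp
  then show ?thesis using openin_subset by blast
qed

lemma Some_measurable [measurable]: "Some \<in> borel \<rightarrow>\<^sub>M cemetery_algebra"
  unfolding borel_of_def by (rule measurable_measure_of) auto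

lemma Some_image_sets:
  assumes "B \<in> sets borel"
  shows "Some ` B \<in> sets cemetery_algebra"
proof -
  have U: "Some ` S \<in> sets cemetery_algebra" if "open S" for S :: "'a set"
    using that by (intro borel_of_openin) (simp add: vimage_image_eq inj_def)
  from assms have "B \<in> sigma_sets UNIV {S. open S}" by (simp add: borel_def)
  then show ?thesis
  proof induct
    case (Compl a)
    have "Some ` (UNIV - a) = Some ` UNIV - Some ` a" by auto
    then show ?case using Compl U[of UNIV] by (metis open_UNIV sets.Diff)
  next
    case (Union a)
    then show ?case unfolding image_UN by (intro sets.countable_UN) auto
  qed (auto intro: U)
qed

lemma None_sets: "{None} \<in> sets cemetery_algebra"
  by (intro borel_of_openin) (simp add: vimage_def)

text \<open>
Together with \<open>Some_measurable\<close> this identifies the measurable functions on the extended state space: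
a measurable function on the original space and an arbitrary value at the cemetery.
\<close>

lemma measurable_case_option:
  assumes "g \<in> borel \<rightarrow>\<^sub>M M" "c \<in> space M"
  shows "case_option c g \<in> cemetery_algebra \<rightarrow>\<^sub>M M"
proof (rule measurableI)
  fix z :: "'a option"
  show "case_option c g z \<in> space M"
    using assms measurable_space[OF assms(1)] by (cases z) auto
next
  fix A assume A: "A \<in> sets M"
  have "case_option c g -` A = Some ` (g -` A) \<union> (if c \<in> A then {None} else {})"
  proof (rule set_eqI)
    fix z show "z \<in> case_option c g -` A \<longleftrightarrow> z \<in> Some ` (g -` A) \<union> (if c \<in> A then {None} else {})"
      by (cases z) auto
  qed
  moreover have "Some ` (g -` A) \<union> (if c \<in> A then {None} else {}) \<in> sets cemetery_algebra"
    using measurable_sets[OF assms(1) A] by (intro sets.Un) (use Some_image_sets None_sets in auto)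
  ultimately show "case_option c g -` A \<inter> space cemetery_algebra
      \<in> sets cemetery_algebra"
    by simp
qed

text \<open>
The generator consists of sets that avoid the cemetery; the cemetery is still recovered
as the complement of \<open>range Some\<close>.
\<close>

lemma sigma_sets_Some:
  "sets (borel_of (cemetery_topology (euclidean :: 'a::topological_space topology)))
     = sigma_sets UNIV {Some ` U | U :: 'a::topological_space set. open U}"
proof
  show "sigma_sets UNIV {Some ` U | U. open U}
      \<subseteq> sets (borel_of (cemetery_topology (euclidean :: 'a topology)))"
    using sets.top[of "borel_of (cemetery_topology (euclidean :: 'a topology))"]
    by (intro sets.sigma_sets_subset') (auto intro!: Some_image_sets)
  let ?S = "sigma_sets UNIV {Some ` U | U :: 'a set. open U}"
  interpret S: sigma_algebra UNIV ?S by (rule sigma_algebra_sigma_sets) auto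
  have "V \<in> ?S" if "openin (cemetery_topology euclidean) V" for V :: "'a option set"
  proof -
    have 1: "Some ` U \<in> ?S" if "open U" for U :: "'a set" using that by auto
    have "V = Some ` (Some -` V) \<union> (if None \<in> V then UNIV - Some ` UNIV else {})"
      by (auto simp: image_iff) (metis option.exhaust)+
    also have "\<dots> \<in> ?S"
    proof -
      have "Some ` (Some -` V) \<in> ?S" using that by (intro 1) simp
      moreover have "UNIV - Some ` (UNIV :: 'a set) \<in> ?S" by (intro S.Diff S.top 1) simp
      ultimately show ?thesis by (cases "None \<in> V") (simp_all only: if_True if_False Un_empty_right S.Un)
    qed
    finally show ?thesis .
  qed
  then show "sets (borel_of (cemetery_topology (euclidean :: 'a topology))) \<subseteq> ?S"
    unfolding sets_borel_of topspace_cemetery by (intro sigma_sets_mono) auto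
qed

text \<open>
Open sets in a metrizable space are countable unions of an increasing sequence of closed
sets; Urysohn's lemma separates each of these from the complement of the open set.
\<close>

lemma open_indicator_limit:
  fixes U :: "'a::topological_space set"
  assumes "metrizable_space (euclidean :: 'a topology)"
    and "open U"
  obtains f :: "nat \<Rightarrow> 'a \<Rightarrow> real"
  where "\<And>n. continuous_on UNIV (f n)" "\<And>n x. f n x \<in> {0..1}" "\<And>x. (\<lambda>n. f n x) \<longlonglongrightarrow> indicator U x"
proof -
  have "fsigma_in euclidean U" using assms by (intro open_imp_fsigma_in) auto
  then obtain C where C: "\<And>n. closed (C n)" "\<And>n. C n \<subseteq> C (Suc n)" "\<Union> (range C) = U"
    unfolding fsigma_in_ascending by auto
  have "\<exists>f. continuous_on UNIV f \<and> (\<forall>x. f x \<in> {0..1::real}) \<and> f ` (- U) \<subseteq> {0} \<and> f ` C n \<subseteq> {1}" for n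
  proof -
    obtain f where "continuous_map euclidean (top_of_set {0..1::real}) f" "f ` (- U) \<subseteq> {0}" "f ` C n \<subseteq> {1}"
    proof (rule Urysohn_lemma[of euclidean "- U" "C n" 0 1])
      show "normal_space (euclidean :: 'a topology)" using assms by (intro metrizable_imp_normal_space)
      show "disjnt (- U) (C n)" using C(3) by (auto simp: disjnt_def)
    qed (use assms C in auto)
    then show ?thesis by (intro exI[of _ f]) (auto simp: continuous_map_in_subtopology)
  qed
  then obtain f where f: "\<And>n. continuous_on UNIV (f n)" "\<And>n x. f n x \<in> {0..1::real}"
      "\<And>n. f n ` (- U) \<subseteq> {0}" "\<And>n. f n ` C n \<subseteq> {1}" by metis
  have "(\<lambda>n. f n x) \<longlonglongrightarrow> indicator U x" for x
  proof (cases "x \<in> U")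
    case True
    then obtain N where N: "x \<in> C N" using C(3) by blast
    have "x \<in> C n" if "N \<le> n" for n using lift_Suc_mono_le[of C, OF C(2) that] N by auto
    then have "eventually (\<lambda>n. f n x = 1) sequentially"
      using f(4) by (intro eventually_sequentiallyI[of N]) blast
    then show ?thesis using True by (simp add: tendsto_eventually)
  next
    case False
    then have "f n x = 0" for n using f(3) by blast
    then show ?thesis using False by simp
  qed
  then show ?thesis using that f by blast
qed

text \<open>
Here the topology of the state space is the one of its type, as in the definition of superprocesses.
\<close>

locale euclidean_right_process =
  borel_right_process "euclidean :: 'a topology" \<Omega> X Q
  for \<Omega> :: "'w measure" and X :: "real \<Rightarrow> 'w \<Rightarrow> 'a::topological_space option" and Q :: "'a option \<Rightarrow> 'w measure"
begin

text \<open>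
Negative times are identified with time zero, so that the kernel is indexed by all real numbers.
\<close>

definition law :: "real \<Rightarrow> 'a option \<Rightarrow> 'a option measure" where
  "law t z = distr (Q z) cemetery_algebra (X (max 0 t))"

text \<open>
Metrizability is what the Luzin property contributes: it provides enough continuous functions
to test the law on open sets.
\<close>

lemma metrizable: "metrizable_space (euclidean :: 'a topology)"
  using luzin homeomorphic_metrizable_space metrizable_space_subtopology
  unfolding luzin_space_def by blast

lemma X_measurable [measurable]: "0 \<le> t \<Longrightarrow> X t \<in> Q z \<rightarrow>\<^sub>M cemetery_algebra"
  using measurable_process[of t] sets_law[of z] measurable_cong_sets[OF _ refl] by auto

lemma space_Q: "space (Q z) = space \<Omega>"
  using sets_law[of z] by (intro sets_eq_imp_space_eq) simp

lemma sets_law' [simp]: "sets (law t z) = sets cemetery_algebra"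
  by (simp add: law_def)

lemma prob_space_law': "prob_space (law t z)"
  unfolding law_def by (intro prob_space.prob_space_distr prob_space_law X_measurable) auto

lemma emeasure_law_UNIV [simp]: "emeasure (law t z) UNIV = 1"
  using prob_space.emeasure_space_1[OF prob_space_law', of t z] sets_eq_imp_space_eq[OF sets_law', of t z] by simp

lemma emeasure_law_measurable:
  assumes "B \<in> sets cemetery_algebra"
  shows "(\<lambda>z. emeasure (law t z) B) \<in> borel_measurable cemetery_algebra"
  using borel_transition[of "max 0 t" B] assms by (simp add: law_def transition_measure_def)

lemma law_kernel: "law t \<in> cemetery_algebra \<rightarrow>\<^sub>M subprob_algebra cemetery_algebra"
  using emeasure_law_measurable prob_space_law'
  by (intro measurable_subprob_algebra) (auto intro: prob_space_imp_subprob_space)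

lemma law_max [simp]: "law (max 0 t) z = law t z"
  by (simp add: law_def)

lemma integral_law:
  fixes f :: "'a option \<Rightarrow> real"
  assumes "f \<in> borel_measurable cemetery_algebra"
  shows "(\<integral>z. f z \<partial>law t x) = (\<integral>\<omega>. f (X (max 0 t) \<omega>) \<partial>Q x)"
  unfolding law_def using assms by (intro integral_distr X_measurable) auto

lemma path_right_continuous:
  assumes "continuous_on UNIV \<phi>" "\<omega> \<in> space \<Omega>" "0 \<le> t"
  shows "((\<lambda>s. case_option (0::real) \<phi> (X s \<omega>)) \<longlongrightarrow> case_option 0 \<phi> (X t \<omega>)) (at_right t)"
proof (rule topological_tendstoI)
  fix S :: "real set" assume S: "open S" "case_option 0 \<phi> (X t \<omega>) \<in> S"
  have "openin (cemetery_topology euclidean) (case_option 0 \<phi> -` S)"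
    using open_vimage[OF S(1) assms(1)] by (simp add: vimage_def)
  then have "eventually (\<lambda>s. X s \<omega> \<in> case_option 0 \<phi> -` S) (at_right t)"
    using right_continuous[OF assms(2,3)] S(2) unfolding limitin_def by blast
  then show "eventually (\<lambda>s. case_option 0 \<phi> (X s \<omega>) \<in> S) (at_right t)" by simp
qed

text \<open>
For a bounded continuous function \<open>\<phi>\<close> the map \<open>t \<mapsto> \<integral>\<phi> d law t z\<close> is right-continuous, by
right-continuity of the paths and dominated convergence, and it is measurable in \<open>z\<close>; hence it is
jointly measurable. Indicators of open sets are limits of such functions, and the open sets
are an intersection-stable generator.
\<close>

lemma law_jointly_measurable:
  "(\<lambda>(t, z). law t z) \<in> borel \<Otimes>\<^sub>M cemetery_algebra \<rightarrow>\<^sub>M subprob_algebra cemetery_algebra"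
proof (rule measurable_subprob_algebra_generated[OF sigma_sets_Some])
  show "Int_stable {Some ` U | U :: 'a set. open U}"
  proof (rule Int_stableI)
    fix a b assume "a \<in> {Some ` U | U :: 'a set. open U}" "b \<in> {Some ` U | U :: 'a set. open U}"
    then obtain U V :: "'a set" where "a = Some ` U" "b = Some ` V" "open U" "open V" by blast
    then have "a \<inter> b = Some ` (U \<inter> V)" "open (U \<inter> V)" by auto
    then show "a \<inter> b \<in> {Some ` U | U :: 'a set. open U}" by blast
  qed
  fix A assume "A \<in> {Some ` U | U :: 'a set. open U}"
  then obtain U :: "'a set" where U: "A = Some ` U" "open U" by blast
  \<comment> \<open>continuous test functions, extended by zero to the cemetery\<close>
  obtain \<phi> :: "nat \<Rightarrow> 'a \<Rightarrow> real" where \<phi>: "\<And>n. continuous_on UNIV (\<phi> n)" "\<And>n x. \<phi> n x \<in> {0..1}"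
      "\<And>x. (\<lambda>n. \<phi> n x) \<longlonglongrightarrow> indicator U x"
    using open_indicator_limit[OF metrizable U(2)] by blast
  let ?f = "\<lambda>n. case_option 0 (\<phi> n)"
  have fm: "?f n \<in> borel_measurable cemetery_algebra" for n
    by (intro measurable_case_option borel_measurable_continuous_onI \<phi>) auto
  have f1: "norm (?f n z) \<le> 1" for n z using \<phi>(2)[of n] by (auto split: option.splits)
  have joint: "(\<lambda>(t, z). \<integral>y. ?f n y \<partial>law t z) \<in> borel_measurable (borel \<Otimes>\<^sub>M cemetery_algebra)" for n
  proof (rule borel_measurable_LIMSEQ_real)
    fix k
    let ?d = "\<lambda>i. (real_of_int i + 1) / real (Suc k)"
    have step: "(\<lambda>w. \<integral>y. ?f n y \<partial>law (?d i) (snd w)) \<in> borel_measurable (borel \<Otimes>\<^sub>M cemetery_algebra)" for i :: int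
      by (rule measurable_compose[OF measurable_snd
          measurable_compose[OF law_kernel integral_measurable_subprob_algebra[OF fm]]])
    have "(\<lambda>w. \<integral>y. ?f n y \<partial>law (?d \<lfloor>max 0 (fst w) * real (Suc k)\<rfloor>) (snd w))
        \<in> borel_measurable (borel \<Otimes>\<^sub>M cemetery_algebra)"
      by (rule measurable_compose_countable[OF step]) measurable
    then show "(\<lambda>(t, z). \<integral>y. ?f n y \<partial>law (?d \<lfloor>max 0 t * real (Suc k)\<rfloor>) z)
        \<in> borel_measurable (borel \<Otimes>\<^sub>M cemetery_algebra)"
      by (simp add: split_beta')
  next
    fix w :: "real \<times> 'a option"
    obtain t z where w: "w = (t, z)" by force
    define r where "r = max 0 t"
    define d where "d k = (real_of_int \<lfloor>r * real (Suc k)\<rfloor> + 1) / real (Suc k)" for k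
    have d: "r < d k" "d \<longlonglongrightarrow> r" for k
      unfolding d_def by (rule grid_from_right(1), rule grid_from_right(2))
    have r: "0 \<le> r" by (simp add: r_def)
    have "d k > 0" for k using d(1)[of k] r by linarith
    then have pos: "max 0 (d k) = d k" for k by (simp add: less_imp_le max_absorb2)
    have right: "filterlim d (at_right r) sequentially"
      using d by (intro filterlim_at_withinI) auto
    have "(\<lambda>k. \<integral>y. ?f n y \<partial>law (d k) z) \<longlonglongrightarrow> (\<integral>y. ?f n y \<partial>law r z)"
      unfolding integral_law[OF fm] pos
    proof (rule integral_dominated_convergence[where w="\<lambda>_. 1"])
      show "AE \<omega> in Q z. (\<lambda>k. ?f n (X (d k) \<omega>)) \<longlonglongrightarrow> ?f n (X (max 0 r) \<omega>)"
        using filterlim_compose[OF path_right_continuous[OF \<phi>(1)[of n] _ r] right] r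
        by (intro AE_I2) (simp add: space_Q)
      show "integrable (Q z) (\<lambda>_. 1 :: real)"
        using prob_space.finite_measure[OF prob_space_law[of z]] finite_measure.integrable_const by simp
      show "(\<lambda>\<omega>. ?f n (X (d k) \<omega>)) \<in> borel_measurable (Q z)" for k
        using pos[of k] by (intro measurable_compose[OF X_measurable fm]) linarith
      show "(\<lambda>\<omega>. ?f n (X (max 0 r) \<omega>)) \<in> borel_measurable (Q z)"
        by (intro measurable_compose[OF X_measurable fm]) simp
    qed (use f1 in auto)
    then show "(\<lambda>k. case w of (t, z) \<Rightarrow> \<integral>y. ?f n y \<partial>law ((real_of_int \<lfloor>max 0 t * real (Suc k)\<rfloor> + 1) / real (Suc k)) z)
        \<longlonglongrightarrow> (case w of (t, z) \<Rightarrow> \<integral>y. ?f n y \<partial>law t z)"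
      by (simp add: w d_def r_def law_max del: of_nat_Suc)
  qed
  have "(\<lambda>(t, z). measure (law t z) A) \<in> borel_measurable (borel \<Otimes>\<^sub>M cemetery_algebra)"
  proof (rule borel_measurable_LIMSEQ_real[OF _ joint])
    fix w :: "real \<times> 'a option"
    obtain t z where w: "w = (t, z)" by force
    have A: "A \<in> sets cemetery_algebra" using U by (auto intro: Some_image_sets)
    have "(\<lambda>n. \<integral>y. ?f n y \<partial>law t z) \<longlonglongrightarrow> (\<integral>y. indicator A y \<partial>law t z)"
    proof (rule integral_dominated_convergence[where w="\<lambda>_. 1"])
      show "integrable (law t z) (\<lambda>_. 1 :: real)"
        using prob_space.finite_measure[OF prob_space_law'] finite_measure.integrable_const by blast
      show "AE y in law t z. (\<lambda>n. ?f n y) \<longlonglongrightarrow> indicator A y"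
      proof (rule AE_I2)
        fix y show "(\<lambda>n. ?f n y) \<longlonglongrightarrow> indicator A y"
        proof (cases y)
          case None
          then show ?thesis using U by auto
        next
          case (Some x)
          then have "indicator A y = (indicator U x :: real)" using U by (auto simp: indicator_def)
          with Some show ?thesis using \<phi>(3)[of x] by simp
        qed
      qed
    qed (use f1 fm A in \<open>auto simp: measurable_cong_sets[OF sets_law' refl]\<close>)
    then show "(\<lambda>n. case w of (t, z) \<Rightarrow> \<integral>y. ?f n y \<partial>law t z) \<longlonglongrightarrow> (case w of (t, z) \<Rightarrow> measure (law t z) A)"
      using A by (simp add: w)
  qed
  then have "(\<lambda>(t, z). ennreal (measure (law t z) A)) \<in> borel_measurable (borel \<Otimes>\<^sub>M cemetery_algebra)"
    by (simp add: split_beta')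
  then show "(\<lambda>a. emeasure (case a of (t, z) \<Rightarrow> law t z) A) \<in> borel_measurable (borel \<Otimes>\<^sub>M cemetery_algebra)"
    by (simp add: split_beta' finite_measure.emeasure_eq_measure[OF prob_space.finite_measure[OF prob_space_law']])
qed (auto simp: prob_space_imp_subprob_space prob_space_law' split_beta')

lemma prob_space_Q: "prob_space (Q z)"
  by (intro prob_space_law) simp

lemma finite_measure_law: "finite_measure (law t z)"
  by (intro prob_space.finite_measure prob_space_law')

text \<open>
The Markov property at time \<open>s\<close> for the trivial event.
\<close>

lemma law_add:
  assumes "0 \<le> s" "0 \<le> t"
  shows "law (s + t) z = law s z \<bind> law t"
proof (rule measure_eqI)
  have ne: "space (law s z) \<noteq> {}" by (rule prob_space.not_empty[OF prob_space_law'])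
  have K: "law t \<in> law s z \<rightarrow>\<^sub>M subprob_algebra cemetery_algebra"
    using law_kernel measurable_cong_sets[OF sets_law' refl] by blast
  show "sets (law (s + t) z) = sets (law s z \<bind> law t)" using ne by (simp add: sets_bind)
  fix B assume "B \<in> sets (law (s + t) z)"
  then have B: "B \<in> sets cemetery_algebra" by simp
  have "emeasure (law (s + t) z) B = emeasure (Q z) {\<omega> \<in> space \<Omega>. X (s + t) \<omega> \<in> B}"
    using assms B unfolding law_def
    by (subst emeasure_distr) (auto intro!: arg_cong2[where f=emeasure] simp: space_Q)
  also have "\<dots> = (\<integral>\<^sup>+\<omega>\<in>space \<Omega>. emeasure (transition_measure (cemetery_topology euclidean) X Q t (X s \<omega>)) B \<partial>completion (Q z))"
    by (rule markov) (use assms B in \<open>auto simp: natural_filtration_def intro: sigma_sets_top\<close>)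
  also have "\<dots> = (\<integral>\<^sup>+\<omega>. emeasure (law t (X s \<omega>)) B \<partial>Q z)"
    using assms unfolding nn_integral_completion
    by (intro nn_integral_cong) (auto simp: space_Q transition_measure_def law_def)
  also have "\<dots> = (\<integral>\<^sup>+y. emeasure (law t y) B \<partial>law s z)"
    using assms emeasure_law_measurable[OF B] unfolding law_def[of s]
    by (subst nn_integral_distr) (auto intro: X_measurable)
  also have "\<dots> = emeasure (law s z \<bind> law t) B"
    using K B ne by (subst emeasure_bind) auto
  finally show "emeasure (law (s + t) z) B = emeasure (law s z \<bind> law t) B" .
qed

lemma integral_law_add:
  fixes f :: "'a option \<Rightarrow> real"
  assumes "0 \<le> s" "0 \<le> t" "f \<in> borel_measurable cemetery_algebra" "\<And>y. \<bar>f y\<bar> \<le> C"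
  shows "(\<integral>y. f y \<partial>law (s + t) z) = (\<integral>y. (\<integral>v. f v \<partial>law t y) \<partial>law s z)"
proof -
  have K: "law t \<in> law s z \<rightarrow>\<^sub>M subprob_algebra cemetery_algebra"
    using law_kernel measurable_cong_sets[OF sets_law' refl] by blast
  show ?thesis
    unfolding law_add[OF assms(1,2)]
    by (rule integral_bind[OF assms(3) assms(4) K finite_measure_law, where B'=1])
       (auto simp: prob_space.emeasure_space_1[OF prob_space_law'])
qed

lemma integral_law_None:
  fixes f :: "'a option \<Rightarrow> real"
  assumes "f \<in> borel_measurable cemetery_algebra"
  shows "(\<integral>y. f y \<partial>law t None) = f None"
proof -
  have "AE \<omega> in Q None. X 0 \<omega> = None" by (rule normal) simp
  with AE_space have "AE \<omega> in Q None. X (max 0 t) \<omega> = None"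
    by eventually_elim (auto simp: space_Q intro: absorbing[of _ 0])
  then have "(\<integral>\<omega>. f (X (max 0 t) \<omega>) \<partial>Q None) = (\<integral>\<omega>. f None \<partial>Q None)"
    using assms by (intro integral_cong_AE) (auto intro: measurable_compose[OF X_measurable])
  then show ?thesis
    using prob_space.prob_space[OF prob_space_Q[of None]] by (simp add: integral_law[OF assms])
qed

definition kill :: "'a option \<Rightarrow> 'a measure" where
  "kill = case_option (null_measure borel) (return borel)"

text \<open>
The law of the position on the event that the process is still alive: the cemetery
is sent to the zero measure. This realises the convention that functions vanish at the cemetery.
\<close>

definition live_law :: "real \<Rightarrow> 'a \<Rightarrow> 'a measure" where
  "live_law t x = law t (Some x) \<bind> kill"

lemma kill_kernel: "kill \<in> cemetery_algebra \<rightarrow>\<^sub>M subprob_algebra borel"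
  unfolding kill_def by (intro measurable_case_option return_measurable) simp

lemma case_option_measurable:
  "f \<in> borel_measurable borel \<Longrightarrow> case_option (0::real) f \<in> borel_measurable cemetery_algebra"
  by (intro measurable_case_option) auto

lemma integral_live_law:
  assumes "f \<in> bounded_borel"
  shows "(\<integral>y. f y \<partial>live_law t x) = (\<integral>z. case_option 0 f z \<partial>law t (Some x))"
proof -
  have f: "f \<in> borel_measurable borel" using assms by (simp add: bounded_borel_def)
  obtain C where C: "\<And>x. \<bar>f x\<bar> \<le> C"
    using assms by (auto simp: bounded_borel_def bounded_iff)
  have K: "kill \<in> law t (Some x) \<rightarrow>\<^sub>M subprob_algebra borel"
    using kill_kernel measurable_cong_sets[OF sets_law' refl] by blast
  have "(\<integral>y. f y \<partial>live_law t x) = (\<integral>z. (\<integral>y. f y \<partial>kill z) \<partial>law t (Some x))"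
    unfolding live_law_def
  proof (rule integral_bind[OF f C K finite_measure_law, where B'=1])
    show "AE z in law t (Some x). emeasure (kill z) (space (kill z)) \<le> ennreal 1"
      using subprob_space.emeasure_space_le_1[OF subprob_space_kernel[OF kill_kernel]] by (intro AE_I2) simp
  qed
  also have "(\<lambda>z. \<integral>y. f y \<partial>kill z) = case_option 0 f"
  proof
    fix z show "(\<integral>y. f y \<partial>kill z) = case_option 0 f z"
      using f by (cases z) (auto simp: kill_def integral_return)
  qed
  finally show ?thesis .
qed

lemma transition_semigroup_eq_law:
  assumes "0 \<le> t" "f \<in> bounded_borel"
  shows "transition_semigroup X Q t f x = (\<integral>z. case_option 0 f z \<partial>law t (Some x))"
  using assms by (subst integral_law) (auto simp: transition_semigroup_def bounded_borel_def case_option_measurable max_absorb2)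

lemma live_law_kernel: "(\<lambda>(t, x). live_law t x) \<in> borel \<Otimes>\<^sub>M borel \<rightarrow>\<^sub>M subprob_algebra borel"
proof -
  have "(\<lambda>(t, x). (t, Some x)) \<in> borel \<Otimes>\<^sub>M borel \<rightarrow>\<^sub>M (borel :: real measure) \<Otimes>\<^sub>M cemetery_algebra"
    by measurable
  then have "(\<lambda>(t, x). law t (Some x)) \<in> borel \<Otimes>\<^sub>M borel \<rightarrow>\<^sub>M subprob_algebra cemetery_algebra"
    using measurable_compose[OF _ law_jointly_measurable, of "\<lambda>(t, x). (t, Some x)"] by (simp add: split_beta')
  then show ?thesis
    using measurable_bind2[OF _ kill_kernel] by (simp add: live_law_def split_beta')
qed

sublocale submarkov_semigroup "transition_semigroup X Q" live_law
proof
  show "(\<lambda>(t, x). live_law t x) \<in> borel \<Otimes>\<^sub>M borel \<rightarrow>\<^sub>M subprob_algebra borel"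
    by (rule live_law_kernel)
  fix f :: "'a \<Rightarrow> real" and s t :: real and x assume f: "f \<in> bounded_borel"
  show "0 \<le> t \<Longrightarrow> transition_semigroup X Q t f x = (\<integral>y. f y \<partial>live_law t x)"
    using f by (simp add: transition_semigroup_eq_law integral_live_law)
  have fm: "case_option 0 f \<in> borel_measurable cemetery_algebra"
    using f by (simp add: bounded_borel_def case_option_measurable)
  obtain C where C: "\<And>x. \<bar>f x\<bar> \<le> C"
    using f by (auto simp: bounded_borel_def bounded_iff)
  have "0 \<le> C" using C[of x] by linarith
  then have C': "\<bar>case_option 0 f z\<bar> \<le> C" for z using C by (cases z) auto
  have "AE \<omega> in Q (Some x). X 0 \<omega> = Some x" by (rule normal) simp
  then have "(\<integral>\<omega>. case_option 0 f (X 0 \<omega>) \<partial>Q (Some x)) = (\<integral>\<omega>. f x \<partial>Q (Some x))"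
    by (intro integral_cong_AE measurable_compose[OF X_measurable fm]) auto
  then show "transition_semigroup X Q 0 f x = f x"
    using prob_space.prob_space[OF prob_space_Q] by (simp add: transition_semigroup_def)
  assume s: "0 \<le> s" and t: "0 \<le> t"
  let ?Pt = "transition_semigroup X Q t f"
  have Pt: "?Pt \<in> bounded_borel"
  proof -
    have eq: "?Pt = (\<lambda>y. \<integral>z. case_option 0 f z \<partial>law t (Some y))"
      using transition_semigroup_eq_law[OF t f] by auto
    have "?Pt \<in> borel_measurable borel" unfolding eq
      by (rule measurable_compose[OF Some_measurable
          measurable_compose[OF law_kernel integral_measurable_subprob_algebra[OF fm]]])
    moreover have "\<bar>?Pt y\<bar> \<le> C" for y
    proof -
      interpret prob_space "law t (Some y)" by (rule prob_space_law')
      have "\<bar>\<integral>z. case_option 0 f z \<partial>law t (Some y)\<bar> \<le> (\<integral>z. \<bar>case_option 0 f z\<bar> \<partial>law t (Some y))"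
        by (rule integral_abs_bound)
      also have "\<dots> \<le> (\<integral>z. C \<partial>law t (Some y))"
        using C' fm \<open>0 \<le> C\<close> by (intro integral_mono_AE' AE_I2) auto
      also have "\<dots> = C" by (simp add: prob_space)
      finally show ?thesis by (simp add: eq)
    qed
    ultimately show ?thesis by (auto simp: bounded_borel_def bounded_iff intro!: exI[of _ C])
  qed
  have "transition_semigroup X Q s ?Pt x = (\<integral>z. case_option 0 ?Pt z \<partial>law s (Some x))"
    by (rule transition_semigroup_eq_law[OF s Pt])
  also have "case_option 0 ?Pt = (\<lambda>z. \<integral>v. case_option 0 f v \<partial>law t z)"
  proof
    fix z show "case_option 0 ?Pt z = (\<integral>v. case_option 0 f v \<partial>law t z)"
      using transition_semigroup_eq_law[OF t f] integral_law_None[OF fm, of t] by (cases z) auto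
  qed
  also have "(\<integral>z. (\<integral>v. case_option 0 f v \<partial>law t z) \<partial>law s (Some x)) = (\<integral>z. case_option 0 f z \<partial>law (s + t) (Some x))"
    by (rule integral_law_add[OF s t fm C', symmetric])
  also have "\<dots> = transition_semigroup X Q (s + t) f x"
    by (rule transition_semigroup_eq_law[symmetric]) (use s t f in auto)
  finally show "transition_semigroup X Q s ?Pt x = transition_semigroup X Q (s + t) f x" .
qed

end

section \<open>Coming down from infinity\<close>

text \<open>
A continuous function that decreases at rate at least \<open>\<delta>\<close> while it is above \<open>M\<close> loses \<open>\<delta> (s1 - s0)\<close>
if it never hits \<open>M\<close>; and if it hits \<open>M\<close>, it cannot climb above \<open>M\<close> after its last visit.
\<close>

lemma decay_to_level:
  fixes F :: "real \<Rightarrow> real"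
  assumes "s0 \<le> s1" and cont: "continuous_on {s0..s1} F" and "0 \<le> \<delta>"
    and dec: "\<And>s s'. s0 \<le> s \<Longrightarrow> s \<le> s' \<Longrightarrow> s' \<le> s1 \<Longrightarrow> (\<And>r. r \<in> {s..s'} \<Longrightarrow> M \<le> F r) \<Longrightarrow>
      F s' \<le> F s - \<delta> * (s' - s)"
    and start: "F s0 \<le> M + \<delta> * (s1 - s0)"
  shows "F s1 \<le> M"
proof (rule ccontr)
  assume "\<not> F s1 \<le> M"
  then have gt: "M < F s1" by simp
  \<comment> \<open>the last element of \<open>S\<close> is the last visit to the level\<close>
  define S where "S = {s0..s1} \<inter> F -` {M}"
  have hit: "\<exists>s\<in>S. r \<le> s" if "r \<in> {s0..s1}" "F r \<le> M" for r
    using IVT'[of F r M s1] that gt continuous_on_subset[OF cont, of "{r..s1}"] by (auto simp: S_def)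
  show False
  proof (cases "\<exists>r\<in>{s0..s1}. F r \<le> M")
    case False
    then have "F s1 \<le> F s0 - \<delta> * (s1 - s0)" using assms(1) by (intro dec) (auto intro: less_imp_le simp: not_le)
    then show ?thesis using start gt by simp
  next
    case True
    then have "S \<noteq> {}" using hit by blast
    moreover have "compact S"
    proof -
      have "closed S" unfolding S_def by (rule continuous_closed_preimage[OF cont]) auto
      moreover have "bounded S" by (rule bounded_subset[of "{s0..s1}"]) (auto simp: S_def)
      ultimately show ?thesis by (simp add: compact_eq_bounded_closed)
    qed
    ultimately obtain s where s: "s \<in> S" "\<And>r. r \<in> S \<Longrightarrow> r \<le> s" using compact_attains_sup by metis
    have "M \<le> F r" if r: "r \<in> {s..s1}" for r
    proof (rule ccontr)
      assume "\<not> M \<le> F r"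
      then obtain s' where "s' \<in> S" "r \<le> s'" using hit[of r] r s(1) by (auto simp: S_def)
      then have "r = s" using s(2)[of s'] r by auto
      then show False using \<open>\<not> M \<le> F r\<close> s(1) by (simp add: S_def)
    qed
    then have "F s1 \<le> F s - \<delta> * (s1 - s)" using s(1) by (intro dec) (auto simp: S_def)
    moreover have "0 \<le> \<delta> * (s1 - s)" using s(1) assms(3) by (intro mult_nonneg_nonneg) (auto simp: S_def)
    ultimately show ?thesis using gt s(1) by (simp add: S_def)
  qed
qed

text \<open>
Induction on the number of halvings: the descent from \<open>2\<^sup>k\<^sup>+\<^sup>1 M\<close> to \<open>2\<^sup>k M\<close> takes at most the
time \<open>2\<^sup>k M / \<psi>(2\<^sup>k M)\<close>.
\<close>

lemma decay_cascade:
  fixes F \<psi> :: "real \<Rightarrow> real"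
  assumes cont: "continuous_on {s0..s1} F"
    and M: "0 < M" "\<And>j. 0 < \<psi> (2 ^ j * M)"
    and dec: "\<And>j s s'. s0 \<le> s \<Longrightarrow> s \<le> s' \<Longrightarrow> s' \<le> s1 \<Longrightarrow> (\<And>r. r \<in> {s..s'} \<Longrightarrow> 2 ^ j * M \<le> F r) \<Longrightarrow>
      F s' \<le> F s - \<psi> (2 ^ j * M) * (s' - s)"
    and start: "F s0 \<le> 2 ^ k * M" and time: "(\<Sum>j<k. 2 ^ j * M / \<psi> (2 ^ j * M)) \<le> s1 - s0"
  shows "F s1 \<le> M"
  using cont dec start time
proof (induction k arbitrary: s0)
  case 0
  show ?case
  proof (rule decay_to_level[of s0 s1 F "\<psi> M"])
    show "F s' \<le> F s - \<psi> M * (s' - s)" if "s0 \<le> s" "s \<le> s'" "s' \<le> s1" "\<And>r. r \<in> {s..s'} \<Longrightarrow> M \<le> F r" for s s'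
      using "0.prems"(2)[of s s' 0] that by simp
    have "0 \<le> \<psi> M * (s1 - s0)" using M(2)[of 0] 0 by (intro mult_nonneg_nonneg) auto
    then show "F s0 \<le> M + \<psi> M * (s1 - s0)" using 0 by simp
  qed (use 0 M(2)[of 0] in auto)
next
  case (Suc k)
  define M' where "M' = 2 ^ k * M"
  define s where "s = s0 + M' / \<psi> M'"
  have \<psi>M': "0 < \<psi> M'" "0 < M'" using M by (auto simp: M'_def)
  have sum: "(\<Sum>j<k. 2 ^ j * M / \<psi> (2 ^ j * M)) + M' / \<psi> M' \<le> s1 - s0"
    using Suc.prems(4) by (simp add: M'_def)
  have pos: "0 \<le> (\<Sum>j<k. 2 ^ j * M / \<psi> (2 ^ j * M))" using M by (intro sum_nonneg) (auto simp: less_imp_le)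
  have s: "s0 \<le> s" "s \<le> s1" using \<psi>M' sum pos unfolding s_def by auto
  have "F s \<le> M'"
  proof (rule decay_to_level[of s0 s F "\<psi> M'"])
    show "continuous_on {s0..s} F" using Suc.prems(1) s by (auto intro: continuous_on_subset)
    show "F s0 \<le> M' + \<psi> M' * (s - s0)" using Suc.prems(3) \<psi>M' by (simp add: s_def) (simp add: M'_def)
    show "F s'' \<le> F s' - \<psi> M' * (s'' - s')" if "s0 \<le> s'" "s' \<le> s''" "s'' \<le> s" "\<And>r. r \<in> {s'..s''} \<Longrightarrow> M' \<le> F r" for s' s''
      using Suc.prems(2)[of s' s'' k] that s by (simp add: M'_def)
  qed (use s \<psi>M' in auto)
  then show ?case
  proof (intro Suc.IH[of s])
    show "continuous_on {s..s1} F" using Suc.prems(1) s by (auto intro: continuous_on_subset)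
    show "(\<Sum>j<k. 2 ^ j * M / \<psi> (2 ^ j * M)) \<le> s1 - s" using sum by (simp add: s_def)
  qed (use s Suc.prems(2) in \<open>auto simp: M'_def\<close>)
qed

text \<open>
A dyadic Cauchy condensation of the integral: on the interval from \<open>2\<^sup>j N\<close> to \<open>2\<^sup>j\<^sup>+\<^sup>1 N\<close>, whose length is
\<open>2\<^sup>j N\<close>, the monotone function \<open>1 / \<psi>\<close> is at least \<open>1 / \<psi>(2\<^sup>j\<^sup>+\<^sup>1 N)\<close>.
\<close>

lemma summable_dyadic_times:
  fixes \<psi> :: "real \<Rightarrow> real"
  assumes N: "0 < N" and pos: "\<And>l. N \<le> l \<Longrightarrow> 0 < \<psi> l"
    and mono: "\<And>l l'. N \<le> l \<Longrightarrow> l \<le> l' \<Longrightarrow> \<psi> l \<le> \<psi> l'"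
    and int: "set_integrable lborel {N..} (\<lambda>l. 1 / \<psi> l)"
  shows "summable (\<lambda>j. 2 ^ j * N / \<psi> (2 ^ j * N))"
proof -
  define I where "I A = (LINT l:A|lborel. 1 / \<psi> l)" for A
  have sub: "set_integrable lborel A (\<lambda>l. 1 / \<psi> l)" if "A \<in> sets lborel" "A \<subseteq> {N..}" for A
    using set_integrable_subset[OF int that] .
  have pow: "N \<le> 2 ^ k * N" for k using N by simp
  have partial: "(\<Sum>j<k. 2 ^ j * N / \<psi> (2 ^ Suc j * N)) \<le> I {N..<2 ^ k * N}" for k
  proof (induction k)
    case 0 then show ?case by (simp add: I_def set_lebesgue_integral_def)
  next
    case (Suc k)
    let ?a = "2 ^ k * N" and ?b = "2 ^ Suc k * N"
    have ab: "N \<le> ?a" "?a \<le> ?b" using pow[of k] N by auto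
    have "{N..<?b} = {N..<?a} \<union> {?a..<?b}" using ab by auto
    then have "I {N..<?b} = I {N..<?a} + I {?a..<?b}"
      unfolding I_def using ab by (simp only:) (intro set_integral_Un sub, auto)
    moreover have "2 ^ k * N / \<psi> ?b \<le> I {?a..<?b}"
    proof -
      have "(LINT l:{?a..<?b}|lborel. 1 / \<psi> ?b) \<le> I {?a..<?b}"
        unfolding I_def
      proof (rule set_integral_mono)
        show "set_integrable lborel {?a..<?b} (\<lambda>l. 1 / \<psi> ?b)"
          unfolding set_integrable_def using ab by (intro integrable_scaleR_left) (auto simp: integrable_indicator_iff)
        show "1 / \<psi> ?b \<le> 1 / \<psi> l" if "l \<in> {?a..<?b}" for l
          using that ab pos[of l] mono[of l ?b] by (intro divide_left_mono) auto
        show "set_integrable lborel {?a..<?b} (\<lambda>l. 1 / \<psi> l)"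
          using ab by (intro sub) auto
      qed
      then show ?thesis using ab by (simp add: set_lebesgue_integral_def mult.commute[of _ N])
    qed
    ultimately show ?case using Suc by simp
  qed
  have "I {N..<2 ^ k * N} \<le> I {N..}" for k
    unfolding I_def set_lebesgue_integral_def
  proof (rule integral_mono)
    show "integrable lborel (\<lambda>l. indicator {N..<2 ^ k * N} l *\<^sub>R (1 / \<psi> l))"
      using sub[of "{N..<2 ^ k * N}"] unfolding set_integrable_def by fastforce
    show "integrable lborel (\<lambda>l. indicator {N..} l *\<^sub>R (1 / \<psi> l))"
      using int unfolding set_integrable_def .
  qed (use pos in \<open>auto simp: indicator_def less_imp_le\<close>)
  then have "(\<Sum>j<k. 2 ^ j * N / \<psi> (2 ^ Suc j * N)) \<le> I {N..}" for k
    using partial order_trans by blast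
  moreover have "0 \<le> 2 ^ j * N / \<psi> (2 ^ Suc j * N)" for j
    using N pos[OF pow[of "Suc j"]] by (intro divide_nonneg_pos) auto
  ultimately have "summable (\<lambda>j. 2 ^ j * N / \<psi> (2 ^ Suc j * N))"
    by (intro summableI_nonneg_bounded) auto
  then have "summable (\<lambda>j. 2 * (2 ^ j * N / \<psi> (2 ^ Suc j * N)))" by (rule summable_mult)
  then have "summable (\<lambda>j. 2 ^ Suc j * N / \<psi> (2 ^ Suc j * N))" by (simp only: power_Suc times_divide_eq_right mult.assoc)
  then show ?thesis by (subst (asm) summable_Suc_iff)
qed

context submarkov_semigroup
begin

text \<open>
Jensen's inequality for a sub-Markov semigroup at the level \<open>M\<close>. The affine minorant
\<open>p v - (p M - c)\<close> has a nonpositive constant term, and the missing mass of the semigroup can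
only shrink that term; this is where \<open>c \<le> p M\<close> enters.
\<close>

lemma semigroup_tangent_bound:
  assumes t: "0 \<le> t" and v: "v \<in> bounded_borel" and h: "h \<in> bounded_borel"
    and tangent: "\<And>y. c + p * (v y - M) \<le> h y" and c: "c \<le> p * M" and p: "0 \<le> p"
    and level: "M \<le> P t v x"
  shows "c \<le> P t h x"
proof -
  have "P t (\<lambda>y. p * v y - (p * M - c)) x \<le> P t h x"
    using tangent by (intro semigroup_mono t bounded_borel_diff bounded_borel_cmult bounded_borel_const v h)
       (simp add: algebra_simps)
  moreover have "P t (\<lambda>y. p * v y - (p * M - c)) x = p * P t v x - P t (\<lambda>y. p * M - c) x"
    using semigroup_diff[OF t bounded_borel_cmult[OF v] bounded_borel_const] semigroup_cmult[OF t v] by simp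
  moreover have "P t (\<lambda>y. p * M - c) x \<le> p * M - c" using c t by (intro semigroup_const_le) auto
  moreover have "p * M \<le> p * P t v x" using level p by (rule mult_left_mono)
  ultimately show ?thesis by linarith
qed

text \<open>
The scalar cascade applied to \<open>F s = P (t - s) (u s) x\<close>. The initial value only determines how many
halvings are needed, and the time hypothesis covers any number of them.
\<close>

lemma mild_solution_decay:
  fixes \<psi> :: "real \<Rightarrow> real"
  assumes \<Psi>: "borel_mechanism \<Psi>" and f: "f \<in> bounded_borel" and u: "mild_solution P \<Psi> f u"
    and below: "\<And>y l. 0 \<le> l \<Longrightarrow> \<psi> l \<le> \<Psi> y l"
    and tangent: "\<And>j. \<exists>p\<ge>0. \<psi> (2 ^ j * M) \<le> p * (2 ^ j * M) \<and> (\<forall>l\<ge>0. \<psi> (2 ^ j * M) + p * (l - 2 ^ j * M) \<le> \<psi> l)"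
    and M: "0 < M" "\<And>j. 0 < \<psi> (2 ^ j * M)"
    and time: "\<And>k. (\<Sum>j<k. 2 ^ j * M / \<psi> (2 ^ j * M)) \<le> t"
  shows "u t x \<le> M"
proof -
  have t: "0 \<le> t" using time[of 0] by simp
  obtain g B where gm: "g \<in> borel_measurable borel" and gB: "\<And>r. \<bar>g r\<bar> \<le> B"
    and hb: "\<And>r. 0 \<le> r \<Longrightarrow> r \<le> t \<Longrightarrow> (\<lambda>y. \<Psi> y (u r y)) \<in> bounded_borel"
    and g: "\<And>r. 0 \<le> r \<Longrightarrow> r \<le> t \<Longrightarrow> g r = P (t - r) (\<lambda>y. \<Psi> y (u r y)) x"
    and flow: "\<And>s. 0 \<le> s \<Longrightarrow> s \<le> t \<Longrightarrow> P (t - s) (u s) x = P t f x - (LINT r:{0..s}|lborel. g r)"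
    using mild_solution_flow[OF \<Psi> f u t, of x] by blast
  define F where "F s = P (t - s) (u s) x" for s
  have gi: "set_integrable lborel {s..s'} g" for s s'
    unfolding set_integrable_def
  proof (rule integrableI_bounded_set[where A="{s..s'}" and B=B])
    show "(\<lambda>r. indicator {s..s'} r *\<^sub>R g r) \<in> borel_measurable lborel" using gm by simp
  qed (use gB in \<open>auto simp: emeasure_lborel_Icc_eq\<close>)
  have step: "F s' = F s - (LINT r:{s<..s'}|lborel. g r)" if "0 \<le> s" "s \<le> s'" "s' \<le> t" for s s'
  proof -
    have "{0..s'} = {0..s} \<union> {s<..s'}" using that by auto
    then have "(LINT r:{0..s'}|lborel. g r) = (LINT r:{0..s}|lborel. g r) + (LINT r:{s<..s'}|lborel. g r)"
      by (simp only:) (rule set_integral_Un[OF _ gi set_integrable_subset[OF gi[of s s']]], auto)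
    then show ?thesis using flow[of s] flow[of s'] that by (simp add: F_def)
  qed
  have gi': "set_integrable lborel {s<..s'} g" for s s'
    by (rule set_integrable_subset[OF gi[of s s']]) auto
  have ci: "set_integrable lborel {s<..s'} (\<lambda>_. c)" for s s' c :: real
    unfolding set_integrable_def
    by (rule integrableI_bounded_set[where A="{s..s'}" and B="\<bar>c\<bar>"])
       (auto intro!: AE_I2 simp: emeasure_lborel_Icc_eq indicator_def)
  have cI: "(LINT r:{s<..s'}|lborel. c) = c * (s' - s)" if "s \<le> s'" for s s' c :: real
    using that by (simp add: set_lebesgue_integral_def)
  have "continuous_on {0..t} F"
  proof -
    have lip: "\<bar>F s' - F s\<bar> \<le> B * (s' - s)" if "0 \<le> s" "s \<le> s'" "s' \<le> t" for s s'
    proof -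
      have "(LINT r:{s<..s'}|lborel. g r) \<le> (LINT r:{s<..s'}|lborel. B)"
        using gB by (intro set_integral_mono gi' ci) (auto simp: abs_le_iff)
      moreover have "(LINT r:{s<..s'}|lborel. - B) \<le> (LINT r:{s<..s'}|lborel. g r)"
        using gB by (intro set_integral_mono gi' ci) (simp add: abs_le_iff minus_le_iff)
      ultimately show ?thesis using step[OF that] cI[OF that(2), of B] cI[OF that(2), of "- B"] by (simp add: abs_le_iff)
    qed
    have "dist (F s') (F s) \<le> B * dist s' s" if "s \<in> {0..t}" "s' \<in> {0..t}" for s s'
      using lip[of s s'] lip[of s' s] that by (cases "s \<le> s'") (auto simp: dist_real_def abs_minus_commute)
    then have "B-lipschitz_on {0..t} F"
      using gB[of 0] by (intro lipschitz_onI) auto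
    then show ?thesis by (rule lipschitz_on_continuous_on)
  qed
  moreover obtain k where "F 0 \<le> 2 ^ k * M"
  proof -
    obtain k where "F 0 / M < 2 ^ k" using real_arch_pow[of 2 "F 0 / M"] by auto
    then show ?thesis using that[of k] M by (simp add: field_simps)
  qed
  moreover have "F s' \<le> F s - \<psi> (2 ^ j * M) * (s' - s)"
    if s: "0 \<le> s" "s \<le> s'" "s' \<le> t" and level: "\<And>r. r \<in> {s..s'} \<Longrightarrow> 2 ^ j * M \<le> F r" for j s s'
  proof -
    obtain p where p: "0 \<le> p" "\<psi> (2 ^ j * M) \<le> p * (2 ^ j * M)" "\<And>l. 0 \<le> l \<Longrightarrow> \<psi> (2 ^ j * M) + p * (l - 2 ^ j * M) \<le> \<psi> l"
      using tangent[of j] by blast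
    have "\<psi> (2 ^ j * M) \<le> g r" if "r \<in> {s<..s'}" for r
    proof -
      have r: "0 \<le> r" "r \<le> t" using that s by auto
      have "\<psi> (2 ^ j * M) \<le> P (t - r) (\<lambda>y. \<Psi> y (u r y)) x"
      proof (rule semigroup_tangent_bound[OF _ bounded_evolution_bounded_borel[OF mild_solution_evolution[OF u] r(1)] hb[OF r] _ p(2) p(1)])
        show "\<psi> (2 ^ j * M) + p * (u r y - 2 ^ j * M) \<le> \<Psi> y (u r y)" for y
          using p(3)[of "u r y"] below[of "u r y" y] bounded_evolutionD(2)[OF mild_solution_evolution[OF u] r(1), of y] by linarith
        show "2 ^ j * M \<le> P (t - r) (u r) x" using level[of r] that by (simp add: F_def)
      qed (use r in auto)
      then show ?thesis using g[OF r] by simp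
    qed
    then have "(LINT r:{s<..s'}|lborel. \<psi> (2 ^ j * M)) \<le> (LINT r:{s<..s'}|lborel. g r)"
      by (intro set_integral_mono gi' ci) auto
    then show ?thesis using step[OF s] cI[OF s(2)] by simp
  qed
  ultimately have "F t \<le> M"
    using time[of k] by (intro decay_cascade[of 0 t F M \<psi> k] M) auto
  then show ?thesis using semigroup_0[OF bounded_evolution_bounded_borel[OF mild_solution_evolution[OF u] t]] by (simp add: F_def)
qed

text \<open>
Coming down from infinity: the constant depends on \<open>t\<close> but not on the initial value. The supporting
lines of \<open>\<psi>\<close> at levels where \<open>\<psi>\<close> is positive have positive slope, because \<open>\<psi> 0 = 0\<close>; this
gives the monotonicity of \<open>\<psi>\<close> required for the summability of the descent times.
\<close>

theorem mild_solution_instantaneous_bound: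
  fixes \<psi> :: "real \<Rightarrow> real"
  assumes \<Psi>: "borel_mechanism \<Psi>"
    and below: "\<And>y l. 0 \<le> l \<Longrightarrow> \<psi> l \<le> \<Psi> y l"
    and tangent: "\<And>M. 0 \<le> M \<Longrightarrow> \<exists>p. \<forall>l\<ge>0. \<psi> M + p * (l - M) \<le> \<psi> l"
    and zero: "\<psi> 0 = 0" and top: "filterlim \<psi> at_top at_top"
    and int: "\<exists>N>0. set_integrable lborel {N..} (\<lambda>l. 1 / \<psi> l)"
    and t: "0 < t"
  shows "\<exists>C. \<forall>f\<in>bounded_borel. \<forall>u. mild_solution P \<Psi> f u \<longrightarrow> (\<forall>x. u t x \<le> C)"
proof -
  obtain N0 where N0: "0 < N0" "set_integrable lborel {N0..} (\<lambda>l. 1 / \<psi> l)" using int by blast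
  have "eventually (\<lambda>l. 1 \<le> \<psi> l) at_top" using top by (simp add: filterlim_at_top)
  then obtain N1 where N1: "\<And>l. N1 \<le> l \<Longrightarrow> 1 \<le> \<psi> l" by (auto simp: eventually_at_top_linorder)
  define N where "N = max N0 N1"
  have N: "0 < N" "set_integrable lborel {N..} (\<lambda>l. 1 / \<psi> l)"
    using N0 by (auto simp: N_def less_max_iff_disj intro: set_integrable_subset)
  have pos: "0 < \<psi> l" if "N \<le> l" for l using N1[of l] that by (simp add: N_def)
  have slope: "\<exists>p\<ge>0. \<psi> M \<le> p * M \<and> (\<forall>l\<ge>0. \<psi> M + p * (l - M) \<le> \<psi> l)" if "N \<le> M" for M
  proof -
    have M: "0 < M" using that N by simp
    obtain p where p: "\<And>l. 0 \<le> l \<Longrightarrow> \<psi> M + p * (l - M) \<le> \<psi> l" using tangent[of M] M by auto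
    have 1: "\<psi> M \<le> p * M" using p[of 0] zero by simp
    then have "0 < p * M" using pos[OF that] by linarith
    then have "0 \<le> p" using M by (simp add: zero_less_mult_iff)
    then show ?thesis using p 1 by blast
  qed
  have mono: "\<psi> l \<le> \<psi> l'" if l: "N \<le> l" "l \<le> l'" for l l'
  proof -
    obtain p where p: "p \<ge> 0" "\<And>l'. 0 \<le> l' \<Longrightarrow> \<psi> l + p * (l' - l) \<le> \<psi> l'" using slope[OF l(1)] by blast
    have "0 \<le> p * (l' - l)" using p(1) l by simp
    then show ?thesis using p(2)[of l'] l N(1) by linarith
  qed
  define a where "a j = 2 ^ j * N / \<psi> (2 ^ j * N)" for j
  have "summable a" unfolding a_def by (rule summable_dyadic_times[OF N(1) pos mono N(2)])
  then obtain n where n: "\<And>m k. n \<le> m \<Longrightarrow> norm (sum a {m..<k}) < t"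
    using t unfolding summable_Cauchy by blast
  \<comment> \<open>the descent from infinity to this level takes less than time \<open>t\<close>\<close>
  define M where "M = 2 ^ n * N"
  have MN: "N \<le> 2 ^ j * M" for j
    using N(1) by (simp add: M_def power_add[symmetric] mult.assoc[symmetric])
  have time: "(\<Sum>j<k. 2 ^ j * M / \<psi> (2 ^ j * M)) \<le> t" for k
  proof -
    have "(\<Sum>j<k. 2 ^ j * M / \<psi> (2 ^ j * M)) = (\<Sum>j<k. a (j + n))"
      by (simp add: a_def M_def power_add mult.assoc)
    also have "\<dots> = sum a {n..<k + n}"
      using sum.shift_bounds_nat_ivl[of a 0 n k] by (simp add: atLeast0LessThan)
    also have "\<dots> \<le> t" using n[of n "k + n"] by simp
    finally show ?thesis .
  qed
  show ?thesis
  proof (intro exI ballI allI impI)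
    fix f u x assume "f \<in> bounded_borel" "mild_solution P \<Psi> f u"
    then show "u t x \<le> M"
      using MN N(1) pos slope below
      by (intro mild_solution_decay[OF \<Psi> _ _ below _ _ _ time]) (auto simp: M_def)
  qed
qed

end

section \<open>Shifting the mild equation by a stationary solution\<close>

lemma bounded_evolution_add:
  assumes "bounded_evolution u" "w \<in> bounded_borel" "\<And>x. 0 \<le> w x"
  shows "bounded_evolution (\<lambda>t x. u t x + w x)"
proof -
  obtain B where w: "w \<in> borel_measurable borel" "\<And>x. \<bar>w x\<bar> \<le> B" using assms(2) by (meson bounded_borelE)
  have "(\<lambda>(t, x). u t x + w x) \<in> borel_measurable (restrict_space borel {0..} \<Otimes>\<^sub>M borel)"
    using bounded_evolutionD(1)[OF assms(1)] measurable_compose[OF measurable_snd w(1)]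
    unfolding split_beta' by (rule borel_measurable_add)
  moreover have "\<exists>C. \<forall>t\<in>{0..T}. \<forall>x. u t x + w x \<le> C" if T: "0 \<le> T" for T
  proof -
    obtain C where C: "\<And>t x. t \<in> {0..T} \<Longrightarrow> u t x \<le> C" using bounded_evolutionD(3)[OF assms(1) T] by blast
    have "u t x + w x \<le> C + B" if "t \<in> {0..T}" for t x using C[OF that, of x] w(2)[of x] by linarith
    then show ?thesis by blast
  qed
  ultimately show ?thesis using bounded_evolutionD(2)[OF assms(1)] assms(3) by (simp add: bounded_evolution_def)
qed

text \<open>
The subtracted function has to lie below the evolution, since evolutions are nonnegative.
\<close>

lemma bounded_evolution_diff:
  assumes u: "bounded_evolution u" and "w \<in> bounded_borel" "\<And>x. 0 \<le> w x" "\<And>t x. 0 \<le> t \<Longrightarrow> w x \<le> u t x"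
  shows "bounded_evolution (\<lambda>t x. u t x - w x)"
proof -
  have w: "w \<in> borel_measurable borel" using assms(2) by (simp add: bounded_borel_def)
  have "(\<lambda>(t, x). u t x - w x) \<in> borel_measurable (restrict_space borel {0..} \<Otimes>\<^sub>M borel)"
    using bounded_evolutionD(1)[OF u] measurable_compose[OF measurable_snd w]
    unfolding split_beta' by (rule borel_measurable_diff)
  moreover have "\<exists>C. \<forall>t\<in>{0..T}. \<forall>x. u t x - w x \<le> C" if T: "0 \<le> T" for T
  proof -
    obtain C where C: "\<And>t x. t \<in> {0..T} \<Longrightarrow> u t x \<le> C" using bounded_evolutionD(3)[OF u T] by blast
    have "u t x - w x \<le> C" if "t \<in> {0..T}" for t x using C[OF that, of x] assms(3)[of x] by linarith
    then show ?thesis by blast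
  qed
  ultimately show ?thesis using assms(4) by (simp add: bounded_evolution_def)
qed

context submarkov_semigroup
begin

lemma bounded_evolution_integrable:
  assumes \<psi>: "borel_mechanism \<psi>" and u: "bounded_evolution u" and t: "0 \<le> t"
  shows "set_integrable lborel {0..t} (\<lambda>s. P s (\<lambda>y. \<psi> y (u (t - s) y)) x)"
    and "0 \<le> s \<Longrightarrow> s \<le> t \<Longrightarrow> (\<lambda>y. \<psi> y (u (t - s) y)) \<in> bounded_borel"
proof -
  obtain h B where hm: "(\<lambda>(r, y). h r y) \<in> borel_measurable (borel \<Otimes>\<^sub>M borel)" and B: "\<And>r y. \<bar>h r y\<bar> \<le> B"
    and h: "\<And>r. 0 \<le> r \<Longrightarrow> r \<le> t \<Longrightarrow> h r = (\<lambda>y. \<psi> y (u r y))"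
    using bounded_evolution_integrand[OF \<psi> u t] by blast
  have hb: "h r \<in> bounded_borel" for r using measurable_section(1)[OF hm] B by (rule bounded_borelI)
  show "(\<lambda>y. \<psi> y (u (t - s) y)) \<in> bounded_borel" if "0 \<le> s" "s \<le> t" for s
    using hb[of "t - s"] h[of "t - s"] that by simp
  define G where "G s = (\<integral>z. h (t - s) z \<partial>\<kappa> s x)" for s
  have "(\<lambda>r. \<integral>z. h r z \<partial>\<kappa> (t - r) x) \<in> borel_measurable borel"
    by (rule measurable_section(2)[OF measurable_shifted_kernel[OF hm]])
  from measurable_compose[OF _ this, of "\<lambda>s. t - s" borel] have Gm: "G \<in> borel_measurable borel"
    by (simp add: G_def[abs_def])
  have GB: "\<bar>G s\<bar> \<le> B" for s
    unfolding G_def using measurable_section(1)[OF hm] B by (rule abs_integral_kernel_le)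
  have "set_integrable lborel {0..t} G"
    unfolding set_integrable_def
  proof (rule integrableI_bounded_set[where A="{0..t}" and B=B])
    show "(\<lambda>r. indicator {0..t} r *\<^sub>R G r) \<in> borel_measurable lborel" using Gm by simp
  qed (use GB in \<open>auto simp: emeasure_lborel_Icc_eq\<close>)
  moreover have eq: "G s = P s (\<lambda>y. \<psi> y (u (t - s) y)) x" if "s \<in> {0..t}" for s
    using that hb[of "t - s"] h[of "t - s"] by (simp add: G_def semigroup_eq_kernel)
  ultimately show "set_integrable lborel {0..t} (\<lambda>s. P s (\<lambda>y. \<psi> y (u (t - s) y)) x)"
    by (subst set_integrable_cong[OF refl refl, where f'=G]) (use eq in auto)
qed

text \<open>
Subtracting the equation satisfied by the constant evolution \<open>w\<close> from the equation for \<open>v + w\<close> leaves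
the equation for \<open>v\<close> with the shifted nonlinearity. The integrability of both nonlinear terms in time
makes the subtraction legitimate.
\<close>

lemma mild_equation_shift:
  assumes \<Psi>: "borel_mechanism \<Psi>"
    and shift: "\<And>y l. 0 \<le> l \<Longrightarrow> \<Psi>' y l = \<Psi> y (l + w y) - \<Psi> y (w y)"
    and w: "w \<in> bounded_borel" "\<And>y. 0 \<le> w y"
    and stationary: "\<And>t x. 0 \<le> t \<Longrightarrow> w x = P t w x - (LINT s:{0..t}|lborel. P s (\<lambda>y. \<Psi> y (w y)) x)"
    and f: "f \<in> bounded_borel"
    and v: "bounded_evolution v" "bounded_evolution (\<lambda>t y. v t y + w y)"
  shows "mild_solution P \<Psi>' f v \<longleftrightarrow> mild_solution P \<Psi> (\<lambda>y. f y + w y) (\<lambda>t y. v t y + w y)"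
proof -
  have ew: "bounded_evolution (\<lambda>_. w)"
  proof -
    obtain C where "w \<in> borel_measurable borel" "\<And>x. \<bar>w x\<bar> \<le> C" using w(1) by (meson bounded_borelE)
    then show ?thesis using w(2) measurable_compose[OF measurable_snd]
      by (auto simp: bounded_evolution_def split_beta' abs_le_iff)
  qed
  have key: "P t f x - (LINT s:{0..t}|lborel. P s (\<lambda>y. \<Psi>' y (v (t - s) y)) x)
      = P t (\<lambda>y. f y + w y) x - (LINT s:{0..t}|lborel. P s (\<lambda>y. \<Psi> y (v (t - s) y + w y)) x) - w x"
    if t: "0 \<le> t" for t x
  proof -
    have "(LINT s:{0..t}|lborel. P s (\<lambda>y. \<Psi>' y (v (t - s) y)) x)
        = (LINT s:{0..t}|lborel. P s (\<lambda>y. \<Psi> y (v (t - s) y + w y)) x - P s (\<lambda>y. \<Psi> y (w y)) x)"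
    proof (intro set_lebesgue_integral_cong allI impI)
      fix s assume "s \<in> {0..t}"
      then have s: "0 \<le> s" "s \<le> t" by auto
      have "(\<lambda>y. \<Psi>' y (v (t - s) y)) = (\<lambda>y. \<Psi> y (v (t - s) y + w y) - \<Psi> y (w y))"
        using bounded_evolutionD(2)[OF v(1), of "t - s"] s by (simp add: shift)
      then show "P s (\<lambda>y. \<Psi>' y (v (t - s) y)) x = P s (\<lambda>y. \<Psi> y (v (t - s) y + w y)) x - P s (\<lambda>y. \<Psi> y (w y)) x"
        using semigroup_diff[OF s(1) bounded_evolution_integrable(2)[OF \<Psi> v(2) t s] bounded_evolution_integrable(2)[OF \<Psi> ew t s]]
        by simp
    qed auto
    also have "\<dots> = (LINT s:{0..t}|lborel. P s (\<lambda>y. \<Psi> y (v (t - s) y + w y)) x) - (LINT s:{0..t}|lborel. P s (\<lambda>y. \<Psi> y (w y)) x)"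
      by (rule set_integral_diff(2)[OF bounded_evolution_integrable(1)[OF \<Psi> v(2) t] bounded_evolution_integrable(1)[OF \<Psi> ew t]])
    finally have 1: "(LINT s:{0..t}|lborel. P s (\<lambda>y. \<Psi>' y (v (t - s) y)) x) =
        (LINT s:{0..t}|lborel. P s (\<lambda>y. \<Psi> y (v (t - s) y + w y)) x) - (LINT s:{0..t}|lborel. P s (\<lambda>y. \<Psi> y (w y)) x)" .
    have "P t f x = P t (\<lambda>y. f y + w y) x - P t w x"
      using semigroup_diff[OF t bounded_borel_add[OF f w(1)] w(1)] by simp
    then show ?thesis using 1 stationary[OF t, of x] by simp
  qed
  have "v t x = P t f x - (LINT s:{0..t}|lborel. P s (\<lambda>y. \<Psi>' y (v (t - s) y)) x) \<longleftrightarrow>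
      v t x + w x = P t (\<lambda>y. f y + w y) x - (LINT s:{0..t}|lborel. P s (\<lambda>y. \<Psi> y (v (t - s) y + w y)) x)"
    if "0 \<le> t" for t x
    using key[OF that, of x] by linarith
  then show ?thesis using v unfolding mild_solution_iff by blast
qed

end

section \<open>Cumulants and their canonical representation\<close>

context superprocess
begin

lemma cumulant_mild: "f \<in> bounded_borel_nonneg \<Longrightarrow> mild_solution P \<psi> f (\<lambda>t. cumulant P \<psi> t f)"
  using cumulant_equation by (simp add: unique_mild_solution_def)

text \<open>
Started from a unit mass, the superprocess determines the cumulant pointwise.
\<close>

lemma laplace_at_point:
  assumes f: "f \<in> bounded_borel_nonneg" and t: "0 \<le> t"
  shows "(\<integral>\<omega>. exp (- integral\<^sup>L (X t \<omega>) f) \<partial>Pr (return borel x)) = exp (- cumulant P \<psi> t f x)"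
proof -
  have "return borel x \<in> finite_measures"
    by (simp add: finite_measures_def prob_space.finite_measure prob_space_return)
  moreover have "cumulant P \<psi> t f \<in> borel_measurable borel"
    using bounded_evolution_bounded_borel[OF mild_solution_evolution[OF cumulant_mild[OF f]] t] by (simp add: bounded_borel_def)
  ultimately show ?thesis using laplace_functional[OF f _ t] by (simp add: integral_return)
qed

text \<open>
Read off the Laplace functional. The integrals are those of integrable functions because their values
\<open>exp (- V)\<close> do not vanish, whereas a divergent Bochner integral has the value zero.
\<close>

lemma cumulant_mono:
  assumes f: "f \<in> bounded_borel_nonneg" and g: "g \<in> bounded_borel_nonneg" and le: "\<And>x. f x \<le> g x" and t: "0 \<le> t"
  shows "cumulant P \<psi> t f x \<le> cumulant P \<psi> t g x"
proof -
  let ?e = "\<lambda>f \<omega>. exp (- integral\<^sup>L (X t \<omega>) f)" and ?Q = "Pr (return borel x)"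
  have Q: "return borel x \<in> topspace weak_topology"
    by (simp add: finite_measures_def prob_space.finite_measure prob_space_return)
  have space: "space ?Q = space \<Omega>" using sets_law[OF Q] by (rule sets_eq_imp_space_eq)
  have int: "integrable ?Q (?e f)" if "f \<in> bounded_borel_nonneg" for f
    using laplace_at_point[OF that t, of x] not_integrable_integral_eq[of ?Q "?e f"] by auto
  have "(\<integral>\<omega>. ?e g \<omega> \<partial>?Q) \<le> (\<integral>\<omega>. ?e f \<omega> \<partial>?Q)"
  proof (rule integral_mono[OF int[OF g] int[OF f]])
    fix \<omega> assume "\<omega> \<in> space ?Q"
    then have "X t \<omega> \<in> finite_measures"
      using measurable_space[OF measurable_process[OF t]] by (simp add: space)
    then have m: "sets (X t \<omega>) = sets borel" "finite_measure (X t \<omega>)" by (auto simp: finite_measures_def)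
    have "integrable (X t \<omega>) f" if "f \<in> bounded_borel_nonneg" for f
    proof -
      have "f \<in> bounded_borel" using that by (simp add: bounded_borel_nonneg_def)
      then obtain B where "f \<in> borel_measurable borel" "\<And>x. \<bar>f x\<bar> \<le> B" by (meson bounded_borelE)
      then show ?thesis using measurable_cong_sets[OF m(1) refl]
        by (intro finite_measure.integrable_const_bound[OF m(2), where B=B]) auto
    qed
    then have "integral\<^sup>L (X t \<omega>) f \<le> integral\<^sup>L (X t \<omega>) g" using f g le by (intro integral_mono) auto
    then show "?e g \<omega> \<le> ?e f \<omega>" by simp
  qed
  then show ?thesis using laplace_at_point[OF f t] laplace_at_point[OF g t] by simp
qed

end

text \<open>
On constants the drift part grows linearly and the part given by \<open>L\<close> is nonnegative.
\<close>

lemma E_zero_of_bounded_cumulant: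
  assumes rep: "canonical_representation V \<Lambda> L"
    and bound: "\<And>t x. 0 < t \<Longrightarrow> \<exists>C. \<forall>c\<ge>0. V t (\<lambda>_. c) x \<le> C"
  shows "E_zero \<Lambda> = UNIV"
proof -
  have "emeasure (\<Lambda> t x) UNIV = 0" if t: "0 < t" for t x
  proof -
    obtain C where C: "\<And>c. 0 \<le> c \<Longrightarrow> V t (\<lambda>_. c) x \<le> C" using bound[OF t] by blast
    have \<Lambda>: "sets (\<Lambda> t x) = sets borel" "bounded_kernel borel (\<lambda>x. emeasure (\<Lambda> t x))"
      and eq: "\<And>f. f \<in> bounded_borel_nonneg \<Longrightarrow>
        V t f x = (\<integral>y. f y \<partial>\<Lambda> t x) + (\<integral>\<nu>. (1 - exp (- integral\<^sup>L \<nu> f)) \<partial>L t x)"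
      using rep t unfolding canonical_representation_def by blast+
    have "emeasure (\<Lambda> t x) UNIV \<le> (SUP x. emeasure (\<Lambda> t x) (space borel))"
      unfolding space_borel by (rule SUP_upper) simp
    also have "\<dots> < \<infinity>" using \<Lambda>(2) by (simp add: bounded_kernel_def)
    finally have fin: "emeasure (\<Lambda> t x) UNIV < \<infinity>" .
    have sp: "space (\<Lambda> t x) = UNIV" using sets_eq_imp_space_eq[OF \<Lambda>(1)] by simp
    have lin: "c * measure (\<Lambda> t x) UNIV \<le> C" if "0 \<le> c" for c
    proof -
      have f: "(\<lambda>_. c) \<in> bounded_borel_nonneg" using that by (simp add: bounded_borel_nonneg_def bounded_borel_const)
      have "0 \<le> (\<integral>\<nu>. (1 - exp (- integral\<^sup>L \<nu> (\<lambda>_. c))) \<partial>L t x)"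
        using that by (intro Bochner_Integration.integral_nonneg) (simp add: Bochner_Integration.integral_nonneg)
      then show ?thesis using eq[OF f] C[OF that] by (simp add: sp mult.commute)
    qed
    have "measure (\<Lambda> t x) UNIV = 0"
    proof (rule ccontr)
      assume "measure (\<Lambda> t x) UNIV \<noteq> 0"
      then have pos: "0 < measure (\<Lambda> t x) UNIV" by (simp add: less_le)
      have "(\<bar>C\<bar> + 1) / measure (\<Lambda> t x) UNIV * measure (\<Lambda> t x) UNIV \<le> C" using pos by (intro lin) auto
      then show False using pos by simp
    qed
    then show ?thesis using fin by (auto simp: measure_def enn2real_eq_0_iff)
  qed
  then show ?thesis by (auto simp: E_zero_def)
qed

section \<open>The drift part of the tilted superprocess\<close>

theorem proposition2p6:
  fixes m :: "'a::topological_space measure"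
    and \<Xi> :: "'w measure" and \<xi> :: "real \<Rightarrow> 'w \<Rightarrow> 'a option" and Q :: "'a option \<Rightarrow> 'w measure"
    and \<Omega> :: "'v measure" and X :: "real \<Rightarrow> 'v \<Rightarrow> 'a measure" and Pr :: "'a measure \<Rightarrow> 'v measure"
    and \<alpha> \<beta> w :: "'a \<Rightarrow> real" and \<pi> :: "'a \<Rightarrow> real measure"
    and \<Lambda> \<Lambda>' :: "real \<Rightarrow> 'a \<Rightarrow> 'a measure" and L L' :: "real \<Rightarrow> 'a \<Rightarrow> 'a measure measure"
    and b a :: real and \<eta> :: "real measure"
  assumes "borel_right_process euclidean \<Xi> \<xi> Q"
    and "symmetric_semigroup m (transition_semigroup \<xi> Q)"
    and "admissible_branching \<beta> \<alpha> \<pi>"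
    and "superprocess (transition_semigroup \<xi> Q) (branching_mechanism \<beta> \<alpha> \<pi>) \<Omega> X Pr"
    and "canonical_representation
           (cumulant (transition_semigroup \<xi> Q) (branching_mechanism \<beta> \<alpha> \<pi>)) \<Lambda> L"
    and "condition1 X Pr w"
    and "canonical_representation
           (cumulant (transition_semigroup \<xi> Q) (star_branching_mechanism \<beta> \<alpha> \<pi> w)) \<Lambda>' L'"
    and "0 \<le> a"
    and "sets \<eta> = sets pos_borel"
    and "(\<integral>\<^sup>+y. ennreal (min y (y\<^sup>2)) \<partial>\<eta>) < \<infinity>"
    and "filterlim (branching_function b a \<eta>) at_top at_top"
    and "\<exists>N>0. set_integrable lborel {N..} (\<lambda>l. 1 / branching_function b a \<eta> l)"
    and "\<forall>x. \<forall>l\<ge>0. branching_function b a \<eta> l \<le> branching_mechanism \<beta> \<alpha> \<pi> x l"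
  shows "E_zero \<Lambda>' = UNIV \<and> assumption1i X Pr w \<alpha> \<Lambda> \<Lambda>'"
proof -
  let ?P = "transition_semigroup \<xi> Q" and ?\<Psi> = "branching_mechanism \<beta> \<alpha> \<pi>"
    and ?\<Psi>' = "star_branching_mechanism \<beta> \<alpha> \<pi> w"
  let ?V = "cumulant ?P ?\<Psi>"
  interpret R: euclidean_right_process \<Xi> \<xi> Q
    using assms(1) by (simp add: euclidean_right_process_def)
  interpret S: superprocess ?P ?\<Psi> \<Omega> X Pr by (rule assms(4))
  interpret \<eta>: jump_measure \<eta> using assms(9,10) by unfold_locales
  note \<Psi> = borel_mechanism_branching[OF assms(3)]
  have w: "w \<in> bounded_borel" "\<And>x. 0 < w x" and w0: "\<And>x. 0 \<le> w x" and wn: "w \<in> bounded_borel_nonneg"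
    using assms(6) by (auto simp: condition1_def bounded_borel_nonneg_def less_imp_le)
  have add_w: "(\<lambda>y. f y + w y) \<in> bounded_borel_nonneg" if "f \<in> bounded_borel_nonneg" for f
    using that w0 w(1) by (auto simp: bounded_borel_nonneg_def intro: bounded_borel_add)
  have Vw: "?V t w = w" if "0 \<le> t" for t
  proof
    fix x show "?V t w x = w x"
      using assms(6) S.laplace_at_point[OF wn that, of x] that by (auto simp: condition1_def)
  qed
  \<comment> \<open>the mild equation for \<open>V\<^sub>t w = w\<close>\<close>
  have stationary: "w x = ?P t w x - (LINT s:{0..t}|lborel. ?P s (\<lambda>y. ?\<Psi> y (w y)) x)" if "0 \<le> t" for t x
  proof -
    have "(LINT s:{0..t}|lborel. ?P s (\<lambda>y. ?\<Psi> y (?V (t - s) w y)) x) = (LINT s:{0..t}|lborel. ?P s (\<lambda>y. ?\<Psi> y (w y)) x)"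
      by (intro set_lebesgue_integral_cong) (auto simp: Vw)
    moreover have "?V t w x = ?P t w x - (LINT s:{0..t}|lborel. ?P s (\<lambda>y. ?\<Psi> y (?V (t - s) w y)) x)"
      using S.cumulant_mild[OF wn] that unfolding mild_solution_iff by blast
    ultimately show ?thesis using Vw[OF that] by simp
  qed
  have shift: "?\<Psi>' y l = ?\<Psi> y (l + w y) - ?\<Psi> y (w y)" if "0 \<le> l" for y l
    using star_branching_mechanism_eq[OF assms(3) w0 that] .
  have equiv: "mild_solution ?P ?\<Psi>' f v \<longleftrightarrow> mild_solution ?P ?\<Psi> (\<lambda>y. f y + w y) (\<lambda>t y. v t y + w y)"
    if "f \<in> bounded_borel" "bounded_evolution v" "bounded_evolution (\<lambda>t y. v t y + w y)" for f v
    by (rule R.mild_equation_shift[OF \<Psi> shift w(1) w0 stationary that])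
  have V': "cumulant ?P ?\<Psi>' t f x = ?V t (\<lambda>y. f y + w y) x - w x"
    if f: "f \<in> bounded_borel_nonneg" and t: "0 \<le> t" for t f x
  proof -
    let ?u = "\<lambda>t. ?V t (\<lambda>y. f y + w y)"
    have fb: "f \<in> bounded_borel" and f0: "\<And>y. 0 \<le> f y" using f by (auto simp: bounded_borel_nonneg_def)
    note u = S.cumulant_mild[OF add_w[OF f]]
    \<comment> \<open>monotonicity of the cumulant makes the shifted solution nonnegative\<close>
    have "w y \<le> ?u s y" if "0 \<le> s" for s y
      using S.cumulant_mono[OF wn add_w[OF f] _ that, of y] f0 by (simp add: Vw[OF that])
    then have "bounded_evolution (\<lambda>s y. ?u s y - w y)"
      by (intro bounded_evolution_diff mild_solution_evolution[OF u] w(1) w0)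
    then have sol: "mild_solution ?P ?\<Psi>' f (\<lambda>s y. ?u s y - w y)"
      using equiv[OF fb, of "\<lambda>s y. ?u s y - w y"] u mild_solution_evolution[OF u] by simp
    \<comment> \<open>the value selected by the definition of the cumulant is unambiguous\<close>
    have unique: "v t x = ?u t x - w x" if v: "mild_solution ?P ?\<Psi>' f v" for v
    proof -
      have "bounded_evolution v" using v by (rule mild_solution_evolution)
      then have "mild_solution ?P ?\<Psi> (\<lambda>y. f y + w y) (\<lambda>s y. v s y + w y)"
        using equiv[OF fb, of v] bounded_evolution_add[OF _ w(1) w0, of v] v by blast
      then have "(\<lambda>y. v t y + w y) = ?u t"
        using S.cumulant_equation[OF add_w[OF f]] t unfolding unique_mild_solution_def by blast
      then show ?thesis by (metis add_diff_cancel_right')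
    qed
    show ?thesis unfolding cumulant_def[of ?P ?\<Psi>']
      using sol unique by (intro the_equality) blast+
  qed
  have bound: "\<exists>C. \<forall>f\<in>bounded_borel_nonneg. \<forall>x. ?V t f x \<le> C" if "0 < t" for t
  proof -
    have "\<exists>C. \<forall>f\<in>bounded_borel. \<forall>u. mild_solution ?P ?\<Psi> f u \<longrightarrow> (\<forall>x. u t x \<le> C)"
    proof (rule R.mild_solution_instantaneous_bound[OF \<Psi> _ _ _ assms(11,12) that])
      show "\<exists>p. \<forall>l\<ge>0. branching_function b a \<eta> M + p * (l - M) \<le> branching_function b a \<eta> l" if "0 \<le> M" for M
        using \<eta>.branching_function_tangent[OF assms(8) that] by metis
    qed (use assms(13) in auto)
    then obtain C where "\<And>f u x. f \<in> bounded_borel \<Longrightarrow> mild_solution ?P ?\<Psi> f u \<Longrightarrow> u t x \<le> C" by blast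
    then show ?thesis using S.cumulant_mild by (intro exI[of _ C]) (auto simp: bounded_borel_nonneg_def)
  qed
  have const: "(\<lambda>_. c) \<in> bounded_borel_nonneg" if "0 \<le> c" for c
    using that by (simp add: bounded_borel_nonneg_def bounded_borel_const)
  have "E_zero \<Lambda> = UNIV"
    using assms(5)
  proof (rule E_zero_of_bounded_cumulant)
    fix t :: real and x assume t: "0 < t"
    obtain C where "\<And>f x. f \<in> bounded_borel_nonneg \<Longrightarrow> ?V t f x \<le> C" using bound[OF t] by blast
    then show "\<exists>C. \<forall>c\<ge>0. ?V t (\<lambda>_. c) x \<le> C" using const by blast
  qed
  moreover have "E_zero \<Lambda>' = UNIV"
    using assms(7)
  proof (rule E_zero_of_bounded_cumulant)
    fix t :: real and x assume t: "0 < t"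
    obtain C where C: "\<And>f x. f \<in> bounded_borel_nonneg \<Longrightarrow> ?V t f x \<le> C" using bound[OF t] by blast
    have "cumulant ?P ?\<Psi>' t (\<lambda>_. c) x \<le> C" if "0 \<le> c" for c
      using V'[OF const[OF that], of t x] C[OF add_w[OF const[OF that]], of x] w0[of x] t by simp
    then show "\<exists>C. \<forall>c\<ge>0. cumulant ?P ?\<Psi>' t (\<lambda>_. c) x \<le> C" by blast
  qed
  ultimately show ?thesis using assms(6) by (simp add: assumption1i_def)
qed

end
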